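(* There exists an absolute constant $c>0$ such that the following holds. Let $N \geq 1+\exp(e^e)$ be an integer and let $A,B,C$ be nonempty subsets of $\mathbb{Z}/N\mathbb{Z}$ of respective densities $\alpha=|A|/N$, $\beta=|B|/N$, $\gamma=|C|/N$. If $$\alpha\,\Big(\log \tfrac{2}{\alpha\beta\gamma}\Big)^{-5/2} \geq (c\log N)^{-1/2},$$ then $A+B+C$ contains an arithmetic progression of length at least $$N^{\,c\,\alpha^2/\log^4(2/\alpha\beta\gamma)}$$ such that each element of the progression has at least $\tfrac12\alpha\beta\gamma N^2$ representations as a sum $x+y+z$ with $(x,y,z)\in A\times B\times C$.
   Context: All logarithms are natural logarithms. *)

theory Defs
  imports Complex_Main
begin

text \<open>Z/NZ is modelled by residues {0..<N} (as naturals) with addition mod N.\<close>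

definition reps3 :: "nat \<Rightarrow> nat set \<Rightarrow> nat set \<Rightarrow> nat set \<Rightarrow> nat \<Rightarrow> nat" where
  "reps3 N A B C t = card {(x, y, z). x \<in> A \<and> y \<in> B \<and> z \<in> C \<and> (x + y + z) mod N = t}"

definition sumset3 :: "nat \<Rightarrow> nat set \<Rightarrow> nat set \<Rightarrow> nat set \<Rightarrow> nat set" where
  "sumset3 N A B C = {(x + y + z) mod N | x y z. x \<in> A \<and> y \<in> B \<and> z \<in> C}"

definition ap_mod :: "nat \<Rightarrow> nat \<Rightarrow> nat \<Rightarrow> nat \<Rightarrow> nat set" where
  "ap_mod N a d L = (\<lambda>i. (a + i * d) mod N) ` {..<L}"

end

(* The theorem follows from a Croot-Sisask almost-periodicity argument in the supremum norm, combined
   with Chang's theorem. Write r(y) for the number of representations of y. Approximating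
   the average of 1_A over y - B by m random elements of B, Hoeffding's inequality and an averaging over
   diagonal translates give a set T of density at least beta^m / 2 with r(y + t - t') close to r(y) for
   all t, t' in T and all y; the translates of -C then smooth out the few bad points, so
   that m of order alpha^-2 k^2 log(2 / alpha beta gamma) suffices for an error of order alpha beta gamma / k.
   Averaging k times over T - T therefore changes r by a small multiple of its mean, while the Fourier
   coefficients at frequencies with |1_T^| <= |T| / 2 are damped by 4^-k. With k of order
   log(2 / alpha beta gamma) only the large spectrum of T matters, which by Chang's theorem lies in the
   {-1, 0, 1}-span of d = O(log(N / |T|)) = O(alpha^-2 log^4(2 / alpha beta gamma)) frequencies. By Dirichlet's theorem
   there is s <= Q^d such that r is nearly constant along y, y + s, ..., y + (l - 1) s; we start at y where r
   is at least its mean, and l Q^d <= N keeps the terms distinct even when N is composite. *)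
theory Submission
  imports Defs "HOL-Analysis.Kronecker_Approximation_Theorem" "HOL-Analysis.Harmonic_Numbers"
begin

section \<open>Hoeffding's inequality for samples with repetition\<close>

text \<open>For negative x put y = -x: the product (1 + y + y^2/2)(1 - y + y^2) equals 1 + (y^2 +
  y^3 + y^4)/2, so it is at least 1, and its first factor is at most exp y.\<close>

lemma exp_le_quadratic:
  fixes x :: real
  assumes "\<bar>x\<bar> \<le> 1"
  shows "exp x \<le> 1 + x + x\<^sup>2"
proof (cases "0 \<le> x")
  case True
  then show ?thesis using exp_bound assms by auto
next
  case False
  define y where "y = - x"
  have y: "0 \<le> y" using False by (simp add: y_def)
  have "0 \<le> y * (y * y) + y * (y * (y * y)) + y * y" using y by simp
  then have "1 \<le> (1 + y + y\<^sup>2 / 2) * (1 - y + y\<^sup>2)"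
    by (simp add: field_simps power2_eq_square)
  also have "\<dots> \<le> exp y * (1 - y + y\<^sup>2)"
  proof (rule mult_right_mono)
    show "0 \<le> 1 - y + y\<^sup>2" using y assms by (simp add: y_def)
  qed (rule exp_lower_Taylor_quadratic[OF y])
  finally have "exp (- y) \<le> 1 - y + y\<^sup>2"
    by (simp add: exp_minus field_simps)
  then show ?thesis by (simp add: y_def)
qed

text \<open>Independence of the entries of a uniform sample from B^m: exponential moments of sums
  over the sample factor.\<close>

lemma sum_lists_prod_list:
  fixes f :: "'a \<Rightarrow> 'b::comm_semiring_1"
  assumes "finite B"
  shows "(\<Sum>xs | set xs \<subseteq> B \<and> length xs = m. prod_list (map f xs)) = (\<Sum>b\<in>B. f b) ^ m"
proof (induction m)
  case 0
  have "{xs. set xs \<subseteq> B \<and> length xs = 0} = {[]}" by auto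
  then show ?case by simp
next
  case (Suc m)
  let ?X = "\<lambda>m. {xs. set xs \<subseteq> B \<and> length xs = m}"
  have "?X (Suc m) = (\<lambda>(b, xs). b # xs) ` (B \<times> ?X m)"
    by (auto simp: length_Suc_conv image_iff)
  moreover have "inj_on (\<lambda>(b, xs). b # xs) (B \<times> ?X m)"
    by (auto simp: inj_on_def)
  ultimately have "(\<Sum>xs\<in>?X (Suc m). prod_list (map f xs))
      = (\<Sum>(b, xs)\<in>B \<times> ?X m. f b * prod_list (map f xs))"
    by (simp add: sum.reindex case_prod_unfold)
  also have "\<dots> = (\<Sum>b\<in>B. f b) * (\<Sum>xs\<in>?X m. prod_list (map f xs))"
    by (simp add: sum.cartesian_product[symmetric] sum_product)
  finally show ?case using Suc by simp
qed

lemma exp_mult_sum_list: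
  fixes f :: "'a \<Rightarrow> real"
  shows "exp (s * sum_list (map f xs)) = prod_list (map (\<lambda>b. exp (s * f b)) xs)"
  by (induction xs) (auto simp: exp_add ring_distribs)

text \<open>Markov's inequality for the exponential moment. Since f has mean zero, the linear term
  of each factor vanishes and each entry costs at most |B| exp(s^2).\<close>

lemma Chernoff_lists:
  fixes f :: "'a \<Rightarrow> real"
  assumes B: "finite B" and f: "\<And>b. b \<in> B \<Longrightarrow> \<bar>f b\<bar> \<le> 1" and f0: "(\<Sum>b\<in>B. f b) = 0"
    and e: "0 \<le> e" "e \<le> 1"
  shows "real (card {xs. set xs \<subseteq> B \<and> length xs = m \<and> e * m < sum_list (map f xs)})
    \<le> real (card B) ^ m * exp (- e\<^sup>2 * m / 4)"
proof -
  let ?X = "{xs. set xs \<subseteq> B \<and> length xs = m}"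
  let ?S = "{xs. set xs \<subseteq> B \<and> length xs = m \<and> e * m < sum_list (map f xs)}"
  \<comment> \<open>This value minimises the exponent m (s^2 - s e), which becomes -e^2 m /
    4.\<close>
  define s where "s = e / 2"
  have fin: "finite ?X" using B by (rule finite_lists_length_eq)
  have s: "0 \<le> s" "s \<le> 1" using e by (auto simp: s_def)
  have "real (card ?S) * exp (s * (e * m)) = (\<Sum>xs\<in>?S. exp (s * (e * m)))" by simp
  also have "\<dots> \<le> (\<Sum>xs\<in>?S. exp (s * sum_list (map f xs)))"
    using s by (intro sum_mono) (auto intro!: mult_left_mono)
  also have "\<dots> \<le> (\<Sum>xs\<in>?X. exp (s * sum_list (map f xs)))"
    using fin by (intro sum_mono2) auto
  also have "\<dots> = (\<Sum>xs\<in>?X. prod_list (map (\<lambda>b. exp (s * f b)) xs))"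
    by (simp only: exp_mult_sum_list)
  also have "\<dots> = (\<Sum>b\<in>B. exp (s * f b)) ^ m"
    by (rule sum_lists_prod_list[OF B])
  also have "\<dots> \<le> (real (card B) * exp (s\<^sup>2)) ^ m"
  proof (intro power_mono sum_nonneg)
    have "(\<Sum>b\<in>B. exp (s * f b)) \<le> (\<Sum>b\<in>B. 1 + s * f b + s\<^sup>2)"
    proof (rule sum_mono)
      fix b assume "b \<in> B"
      then have fb: "\<bar>f b\<bar> \<le> 1" by (rule f)
      have "\<bar>s * f b\<bar> \<le> 1" using s fb by (simp add: abs_mult mult_le_one)
      then have "exp (s * f b) \<le> 1 + s * f b + (s * f b)\<^sup>2" by (rule exp_le_quadratic)
      also have "(s * f b)\<^sup>2 \<le> s\<^sup>2"
        using fb s abs_square_le_1[of "f b"] by (simp add: power_mult_distrib mult_left_le)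
      finally show "exp (s * f b) \<le> 1 + s * f b + s\<^sup>2" by simp
    qed
    also have "\<dots> = card B * (1 + s\<^sup>2)"
      by (simp add: sum.distrib sum_distrib_left[symmetric] f0 algebra_simps)
    also have "\<dots> \<le> card B * exp (s\<^sup>2)"
      by (intro mult_left_mono exp_ge_add_one_self) auto
    finally show "(\<Sum>b\<in>B. exp (s * f b)) \<le> card B * exp (s\<^sup>2)" .
  qed auto
  finally have "real (card ?S) * exp (s * (e * m)) \<le> real (card B) ^ m * exp (m * s\<^sup>2)"
    by (simp add: power_mult_distrib exp_of_nat_mult)
  then have "real (card ?S) \<le> real (card B) ^ m * (exp (m * s\<^sup>2) / exp (s * (e * m)))"
    by (simp add: field_simps)
  also have "exp (m * s\<^sup>2) / exp (s * (e * m)) = exp (- e\<^sup>2 * m / 4)"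
    by (simp add: exp_diff[symmetric] s_def power2_eq_square field_simps)
  finally show ?thesis .
qed

lemma Hoeffding_lists:
  fixes f :: "'a \<Rightarrow> real"
  assumes B: "finite B" and f: "\<And>b. b \<in> B \<Longrightarrow> \<bar>f b\<bar> \<le> 1" and f0: "(\<Sum>b\<in>B. f b) = 0"
    and e: "0 \<le> e" "e \<le> 1"
  shows "real (card {xs. set xs \<subseteq> B \<and> length xs = m \<and> e * m < \<bar>sum_list (map f xs)\<bar>})
    \<le> 2 * real (card B) ^ m * exp (- e\<^sup>2 * m / 4)"
proof -
  let ?S = "\<lambda>f. {xs. set xs \<subseteq> B \<and> length xs = m \<and> e * m < sum_list (map f xs)}"
  have neg: "sum_list (map (\<lambda>b. - f b) xs) = - sum_list (map f xs)" for xs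
    by (induction xs) auto
  have eq: "{xs. set xs \<subseteq> B \<and> length xs = m \<and> e * m < \<bar>sum_list (map f xs)\<bar>}
      = ?S f \<union> ?S (\<lambda>b. - f b)"
    by (auto simp: neg abs_if split: if_splits)
  have "real (card {xs. set xs \<subseteq> B \<and> length xs = m \<and> e * m < \<bar>sum_list (map f xs)\<bar>})
      \<le> real (card (?S f)) + real (card (?S (\<lambda>b. - f b)))"
    unfolding eq of_nat_add[symmetric] of_nat_le_iff by (rule card_Un_le)
  moreover have "real (card (?S f)) \<le> real (card B) ^ m * exp (- e\<^sup>2 * m / 4)"
    by (rule Chernoff_lists) (use assms in auto)
  moreover have "real (card (?S (\<lambda>b. - f b))) \<le> real (card B) ^ m * exp (- e\<^sup>2 * m / 4)"
    by (rule Chernoff_lists) (use assms in \<open>auto simp: sum_negf\<close>)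
  ultimately show ?thesis by linarith
qed

section \<open>Characters, dissociativity and Chang's theorem\<close>

text \<open>The character of frequency n takes the value \<open>ec N (n * x)\<close> at x. With
  integers in place of residues, frequencies and points can be negated and subtracted
  freely.\<close>

definition ec :: "nat \<Rightarrow> int \<Rightarrow> complex" where
  "ec N n = cis (2 * pi * of_int n / of_nat N)"

lemma ec_0 [simp]: "ec N 0 = 1"
  by (simp add: ec_def)

lemma ec_add: "ec N (m + n) = ec N m * ec N n"
  by (simp add: ec_def cis_mult ring_distribs add_divide_distrib)

lemma ec_minus: "ec N (- n) = cnj (ec N n)"
  by (simp add: ec_def cis_cnj)

lemma ec_diff: "ec N (m - n) = ec N m * cnj (ec N n)"
  using ec_add[of N m "- n"] by (simp add: ec_minus)

lemma norm_ec [simp]: "norm (ec N n) = 1"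
  by (simp add: ec_def)

lemma ec_power: "ec N n ^ k = ec N (n * int k)"
  by (induction k) (simp_all add: ring_distribs ec_add)

lemma ec_eq_1_iff:
  assumes "N > 0"
  shows "ec N n = 1 \<longleftrightarrow> int N dvd n"
proof
  assume "ec N n = 1"
  then have "cos (2 * pi * of_int n / of_nat N) = 1"
    by (simp add: ec_def complex_eq_iff)
  then obtain k :: int where "2 * pi * of_int n / of_nat N = k * 2 * pi"
    by (auto simp: cos_one_2pi_int)
  then have "real_of_int n = of_int (k * int N)"
    using assms by (simp add: field_simps)
  then show "int N dvd n" by (simp only: of_int_eq_iff) simp
next
  assume "int N dvd n"
  then obtain k where "n = int N * k" ..
  then have "2 * pi * of_int n / of_nat N = 2 * pi * of_int k"
    using assms by simp
  then show "ec N n = 1" by (simp add: ec_def)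
qed

lemma sum_ec:
  assumes "N > 0"
  shows "(\<Sum>x\<in>{0..<int N}. ec N (n * x)) = (if int N dvd n then of_nat N else 0)"
proof -
  have "{0..<int N} = int ` {..<N}"
    by (simp add: image_int_atLeastLessThan lessThan_atLeast0)
  then have "(\<Sum>x\<in>{0..<int N}. ec N (n * x)) = (\<Sum>k<N. ec N n ^ k)"
    by (simp add: sum.reindex ec_power)
  moreover have "ec N n ^ N = 1"
    using assms by (simp add: ec_power ec_eq_1_iff)
  ultimately show ?thesis
    using ec_eq_1_iff[OF assms, of n] by (auto simp: geometric_sum)
qed

section \<open>Distance of character values from 1\<close>

lemma norm_ec_le: "norm (ec N m - 1) \<le> norm (ec N n - 1) + norm (ec N (m - n) - 1)"
proof -
  have "ec N m - 1 = ec N (m - n) * (ec N n - 1) + (ec N (m - n) - 1)"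
    using ec_add[of N "m - n" n] by (simp add: algebra_simps)
  then show ?thesis
    by (metis norm_ec norm_mult norm_triangle_ineq mult_1)
qed

lemma norm_ec_minus: "norm (ec N (- n) - 1) = norm (ec N n - 1)"
proof -
  have "ec N (- n) - 1 = cnj (ec N n - 1)" by (simp add: ec_minus)
  then show ?thesis by (simp only: complex_mod_cnj)
qed

text \<open>The chord has length 2 |sin (x / 2)|.\<close>

lemma norm_cis_minus_1: "norm (cis x - 1) \<le> \<bar>x\<bar>"
proof -
  have "(norm (cis x - 1))\<^sup>2 = (cos x - 1)\<^sup>2 + (sin x)\<^sup>2"
    by (simp add: cmod_power2)
  also have "\<dots> = 2 - 2 * cos x"
    by (simp add: power2_diff sin_squared_eq)
  also have "\<dots> = 4 * (sin (x / 2))\<^sup>2"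
    using cos_double_sin[of "x / 2"] by simp
  also have "\<dots> \<le> 4 * (x / 2)\<^sup>2"
    using abs_sin_x_le_abs_x[of "x / 2"] by (simp only: abs_le_square_iff)
  also have "\<dots> = \<bar>x\<bar>\<^sup>2" by (simp add: power2_eq_square)
  finally show ?thesis by (rule power2_le_imp_le) simp
qed

text \<open>Whole turns p do not change the character value; p will be the numerator of a Dirichlet
  approximation.\<close>

lemma norm_ec_near:
  assumes "N > 0"
  shows "norm (ec N n - 1) \<le> 2 * pi * \<bar>of_int n / of_nat N - of_int p\<bar>"
proof -
  have "ec N n = cis (2 * pi * (of_int n / of_nat N - of_int p))"
    by (simp add: ec_def right_diff_distrib cis_divide[symmetric])
  also have "norm (\<dots> - 1) \<le> \<bar>2 * pi * (of_int n / of_nat N - of_int p)\<bar>"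
    by (rule norm_cis_minus_1)
  finally show ?thesis by (simp add: abs_mult)
qed

text \<open>The empty list spans all multiples of N, so membership is a condition modulo N although
  the entries are integers.\<close>

fun signed_span :: "nat \<Rightarrow> int list \<Rightarrow> int set" where
  "signed_span N [] = {n. int N dvd n}"
| "signed_span N (l # \<Lambda>) = {n. \<exists>e\<in>{-1, 0, 1}. n - e * l \<in> signed_span N \<Lambda>}"

text \<open>Each entry lies outside the signed span of the entries after it; this is equivalent to
  dissociativity of the entries.\<close>

fun dissociated :: "nat \<Rightarrow> int list \<Rightarrow> bool" where
  "dissociated N [] = True"
| "dissociated N (l # \<Lambda>) \<longleftrightarrow> l \<notin> signed_span N \<Lambda> \<and> dissociated N \<Lambda>"

lemma signed_span_uminus: "n \<in> signed_span N \<Lambda> \<Longrightarrow> - n \<in> signed_span N \<Lambda>"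
proof (induction \<Lambda> arbitrary: n)
  case (Cons l \<Lambda>)
  then obtain e where e: "e \<in> {-1, 0, 1}" "n - e * l \<in> signed_span N \<Lambda>"
    by (simp only: signed_span.simps mem_Collect_eq) blast
  then have "- n - (- e) * l \<in> signed_span N \<Lambda>" "- e \<in> {-1, 0, 1}"
    using Cons.IH[OF e(2)] by (auto simp: algebra_simps)
  then show ?case by (simp only: signed_span.simps mem_Collect_eq) blast
qed auto

text \<open>The distance from 1 is subadditive and even in the frequency, so each generator with
  coefficient -1, 0 or 1 contributes at most r.\<close>

lemma norm_ec_signed_span:
  fixes r :: real
  assumes "N > 0" and "n \<in> signed_span N \<Lambda>" and "\<And>l. l \<in> set \<Lambda> \<Longrightarrow> norm (ec N (l * s) - 1) \<le> r"
  shows "norm (ec N (n * s) - 1) \<le> length \<Lambda> * r"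
  using assms(2,3)
proof (induction \<Lambda> arbitrary: n)
  case Nil
  then have "int N dvd n * s" by simp
  then show ?case using ec_eq_1_iff[OF assms(1)] by simp
next
  case (Cons l \<Lambda>)
  then obtain e where e: "e \<in> {-1, 0, 1}" "n - e * l \<in> signed_span N \<Lambda>"
    by (simp only: signed_span.simps mem_Collect_eq) blast
  have l: "norm (ec N (l * s) - 1) \<le> r" using Cons.prems by simp
  then have r: "0 \<le> r" using norm_ge_zero order_trans by blast
  have "norm (ec N (n * s) - 1) \<le> norm (ec N (e * l * s) - 1) + norm (ec N ((n - e * l) * s) - 1)"
    using norm_ec_le[of N "n * s" "e * l * s"] by (simp add: left_diff_distrib)
  moreover have "norm (ec N (e * l * s) - 1) \<le> r"
    using e(1) l r norm_ec_minus[of N "l * s"] by auto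
  moreover have "norm (ec N ((n - e * l) * s) - 1) \<le> length \<Lambda> * r"
    by (rule Cons.IH[OF e(2)]) (use Cons.prems in auto)
  ultimately show ?case by (simp add: algebra_simps)
qed

text \<open>Relaxed Riesz products: the constant \<open>1 + s\<^sup>2\<close> makes each factor dominate
  \<open>exp (s Re (c l e(l x)))\<close>, while dissociativity still kills every nonconstant term of the sum over \<open>x\<close>.\<close>

definition riesz :: "nat \<Rightarrow> real \<Rightarrow> (int \<Rightarrow> complex) \<Rightarrow> int list \<Rightarrow> int \<Rightarrow> real" where
  "riesz N s c \<Lambda> x = prod_list (map (\<lambda>l. 1 + s\<^sup>2 + s * Re (c l * ec N (l * x))) \<Lambda>)"

text \<open>Since Re w = (w + cnj w) / 2, the factor of l sends the frequency n to n, n + l and n -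
  l. This recursion drives both evaluations of Riesz sums below.\<close>

lemma riesz_Cons:
  "ec N (n * x) * riesz N s c (l # \<Lambda>) x =
    of_real (1 + s\<^sup>2) * (ec N (n * x) * riesz N s c \<Lambda> x)
    + of_real (s / 2) * c l * (ec N ((n + l) * x) * riesz N s c \<Lambda> x)
    + of_real (s / 2) * cnj (c l) * (ec N ((n - l) * x) * riesz N s c \<Lambda> x)"
proof -
  define w where "w = c l * ec N (l * x)"
  have "riesz N s c (l # \<Lambda>) x = (1 + s\<^sup>2 + s * Re w) * riesz N s c \<Lambda> x"
    by (simp add: riesz_def w_def)
  moreover have "complex_of_real (Re w) = (w + cnj w) / 2"
    by (simp add: complex_eq_iff)
  ultimately have "complex_of_real (riesz N s c (l # \<Lambda>) x)
      = (of_real (1 + s\<^sup>2) + of_real s * ((w + cnj w) / 2)) * of_real (riesz N s c \<Lambda> x)"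
    by (simp only: of_real_mult of_real_add)
  then show ?thesis
    by (simp add: w_def ec_add ec_diff algebra_simps)
qed

text \<open>If n is outside the span of l # \<Lambda>, then n, n + l and n - l are outside the span
  of \<Lambda>; at the empty list, orthogonality of characters finishes.\<close>

lemma sum_riesz_eq_0:
  assumes "N > 0" "n \<notin> signed_span N \<Lambda>"
  shows "(\<Sum>x\<in>{0..<int N}. ec N (n * x) * riesz N s c \<Lambda> x) = 0"
  using assms(2)
proof (induction \<Lambda> arbitrary: n)
  case Nil
  then show ?case by (simp add: riesz_def sum_ec[OF assms(1)])
next
  case (Cons l \<Lambda>)
  then have "n \<notin> signed_span N \<Lambda>" "n + l \<notin> signed_span N \<Lambda>" "n - l \<notin> signed_span N \<Lambda>"
    by auto
  then show ?case
    using Cons.IH by (simp only: riesz_Cons sum.distrib sum_distrib_left[symmetric]) simp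
qed

text \<open>In the recursion at n = 0 the two shifted frequencies are l and -l, both outside the
  span of the remaining entries, so only the constant 1 + s^2 survives at each entry.\<close>

lemma sum_riesz:
  assumes "N > 0" "dissociated N \<Lambda>"
  shows "(\<Sum>x\<in>{0..<int N}. riesz N s c \<Lambda> x) = N * (1 + s\<^sup>2) ^ length \<Lambda>"
proof -
  have "(\<Sum>x\<in>{0..<int N}. complex_of_real (riesz N s c \<Lambda> x)) = N * of_real (1 + s\<^sup>2) ^ length \<Lambda>"
    using assms(2)
  proof (induction \<Lambda>)
    case Nil
    then show ?case by (simp add: riesz_def)
  next
    case (Cons l \<Lambda>)
    have l: "l \<notin> signed_span N \<Lambda>" and l': "- l \<notin> signed_span N \<Lambda>"
      using Cons.prems signed_span_uminus[of "- l"] by auto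
    have "(\<Sum>x\<in>{0..<int N}. complex_of_real (riesz N s c (l # \<Lambda>) x))
       = of_real (1 + s\<^sup>2) * (\<Sum>x\<in>{0..<int N}. of_real (riesz N s c \<Lambda> x))
        + of_real (s / 2) * c l * (\<Sum>x\<in>{0..<int N}. ec N (l * x) * riesz N s c \<Lambda> x)
        + of_real (s / 2) * cnj (c l) * (\<Sum>x\<in>{0..<int N}. ec N (- l * x) * riesz N s c \<Lambda> x)"
      using riesz_Cons[of N 0 _ s c l \<Lambda>]
      by (simp only: sum.distrib[symmetric] sum_distrib_left mult_zero_left ec_0 mult_1 add_0 diff_0)
    then show ?case
      using Cons sum_riesz_eq_0[OF assms(1) l] sum_riesz_eq_0[OF assms(1) l'] by simp
  qed
  also have "\<dots> = of_real (N * (1 + s\<^sup>2) ^ length \<Lambda>)" by simp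
  finally show ?thesis unfolding of_real_sum[symmetric] of_real_eq_iff .
qed

lemma riesz_ge_exp:
  assumes s: "0 \<le> s" "s \<le> 1" and c: "\<And>l. norm (c l) \<le> 1"
  shows "exp (s * (\<Sum>l\<leftarrow>\<Lambda>. Re (c l * ec N (l * x)))) \<le> riesz N s c \<Lambda> x"
proof (induction \<Lambda>)
  case (Cons l \<Lambda>)
  let ?u = "Re (c l * ec N (l * x))"
  have u: "\<bar>?u\<bar> \<le> 1"
    using abs_Re_le_cmod[of "c l * ec N (l * x)"] c[of l] by (simp add: norm_mult)
  then have "\<bar>s * ?u\<bar> \<le> 1" using s by (simp only: abs_mult) (simp add: mult_le_one)
  then have "exp (s * ?u) \<le> 1 + s * ?u + (s * ?u)\<^sup>2" by (rule exp_le_quadratic)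
  also have "(s * ?u)\<^sup>2 \<le> s\<^sup>2"
    using u s abs_square_le_1[of ?u] by (simp only: power_mult_distrib) (simp add: mult_left_le)
  finally have "exp (s * ?u) \<le> 1 + s\<^sup>2 + s * ?u" by simp
  then have "exp (s * ?u) * exp (s * (\<Sum>l\<leftarrow>\<Lambda>. Re (c l * ec N (l * x))))
      \<le> (1 + s\<^sup>2 + s * ?u) * riesz N s c \<Lambda> x"
    by (intro mult_mono Cons.IH) (auto intro: order_trans[OF exp_ge_zero])
  then show ?case by (simp add: riesz_def exp_add ring_distribs)
qed (simp add: riesz_def)

text \<open>The unnormalised Fourier transform of the indicator function of A, with a positive sign
  in the exponent.\<close>

definition fsum :: "nat \<Rightarrow> int set \<Rightarrow> int \<Rightarrow> complex" where
  "fsum N A n = (\<Sum>a\<in>A. ec N (n * a))"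

text \<open>Double estimate of the exponential moment of u. On T the mean of u is at least s d / 2,
  while the dominating Riesz product has total mass at most N exp(d s^2) over all residues.\<close>

lemma dissociated_spectrum_length:
  assumes N: "N > 0" and T: "T \<subseteq> {0..<int N}" "T \<noteq> {}" and \<Lambda>: "dissociated N \<Lambda>"
    and large: "\<And>l. l \<in> set \<Lambda> \<Longrightarrow> card T / 2 \<le> norm (fsum N T l)"
  shows "exp (length \<Lambda> / 16) * card T \<le> N"
proof -
  \<comment> \<open>These phases turn each coefficient of T into its absolute value, so that u is
    large on average over T.\<close>
  define c where "c l = cnj (sgn (fsum N T l))" for l
  define d where "d = length \<Lambda>"
  \<comment> \<open>The choice 1/4 maximises s / 2 - s^2; the maximum 1/16 is the constant in the
    conclusion.\<close>
  define s :: real where "s = 1 / 4"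
  define u where "u x = s * (\<Sum>l\<leftarrow>\<Lambda>. Re (c l * ec N (l * x)))" for x
  have c: "norm (c l) \<le> 1" for l by (simp add: c_def norm_sgn)
  have sum_u: "(\<Sum>x\<in>T. u x) = s * (\<Sum>l\<leftarrow>\<Lambda>. norm (fsum N T l))"
  proof -
    have "(\<Sum>x\<in>T. (\<Sum>l\<leftarrow>\<Lambda>. Re (c l * ec N (l * x)))) = (\<Sum>l\<leftarrow>\<Lambda>. Re (c l * fsum N T l))"
      by (induction \<Lambda>) (simp_all add: sum.distrib fsum_def sum_distrib_left)
    moreover have "Re (c l * fsum N T l) = norm (fsum N T l)" for l
    proof -
      have "cnj (sgn z) * z = of_real (norm z)" for z :: complex
      proof (cases "z = 0")
        case False
        have "cnj (sgn z) * z = z * cnj z / of_real (norm z)"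
          by (simp add: sgn_eq mult.commute)
        also have "\<dots> = of_real (norm z)"
          using False by (simp only: complex_norm_square[symmetric]) (simp add: power2_eq_square)
        finally show ?thesis .
      qed simp
      then have "c l * fsum N T l = of_real (norm (fsum N T l))" by (simp add: c_def)
      then show ?thesis by simp
    qed
    ultimately show ?thesis by (simp add: u_def sum_distrib_left[symmetric])
  qed
  have "d * (card T / 2) \<le> (\<Sum>l\<leftarrow>\<Lambda>. norm (fsum N T l))"
    using large unfolding d_def by (induction \<Lambda>) (auto simp: algebra_simps add_divide_distrib add_mono)
  then have su: "card T * (s * d / 2) \<le> (\<Sum>x\<in>T. u x)"
    unfolding sum_u s_def by simp
  \<comment> \<open>Jensen's inequality in tangent-line form: exp u lies above its tangent at s d /
    2.\<close>
  have "card T * exp (s * d / 2) \<le> (\<Sum>x\<in>T. exp (s * d / 2) * (1 + (u x - s * d / 2)))"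
  proof -
    have "card T \<le> (\<Sum>x\<in>T. 1 + (u x - s * d / 2))"
      using su by (simp add: sum.distrib sum_subtractf)
    from mult_left_mono[OF this, of "exp (s * d / 2)"] show ?thesis
      by (simp add: sum_distrib_left mult.commute)
  qed
  also have "\<dots> \<le> (\<Sum>x\<in>T. exp (s * d / 2) * exp (u x - s * d / 2))"
    by (intro sum_mono mult_left_mono exp_ge_add_one_self) auto
  also have "\<dots> = (\<Sum>x\<in>T. exp (u x))"
    by (simp add: exp_add[symmetric])
  also have "\<dots> \<le> (\<Sum>x\<in>T. riesz N s c \<Lambda> x)"
    unfolding u_def by (intro sum_mono riesz_ge_exp c) (auto simp: s_def)
  \<comment> \<open>The Riesz product dominates an exponential, hence is nonnegative, so the sum may
    be extended beyond T.\<close>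
  also have "\<dots> \<le> (\<Sum>x\<in>{0..<int N}. riesz N s c \<Lambda> x)"
    by (intro sum_mono2 T order_trans[OF exp_ge_zero riesz_ge_exp] c) (auto simp: s_def)
  also have "\<dots> = N * (1 + s\<^sup>2) ^ d"
    unfolding d_def by (rule sum_riesz[OF N \<Lambda>])
  also have "\<dots> \<le> N * exp (s\<^sup>2) ^ d"
    by (intro mult_left_mono power_mono exp_ge_add_one_self) auto
  finally have "card T * exp (s * d / 2) \<le> N * exp (d * s\<^sup>2)"
    by (simp add: exp_of_nat_mult)
  then have "card T * (exp (s * d / 2) / exp (d * s\<^sup>2)) \<le> N"
    by (simp add: field_simps)
  also have "exp (s * d / 2) / exp (d * s\<^sup>2) = exp (d / 16)"
    by (simp add: exp_diff[symmetric] s_def power2_eq_square)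
  finally show ?thesis by (simp add: d_def mult.commute)
qed

text \<open>A list \<open>\<Lambda>\<close> in the large spectrum that is as long as possible must span the whole large spectrum.\<close>

lemma Chang:
  assumes N: "N > 0" and T: "T \<subseteq> {0..<int N}" "T \<noteq> {}"
  obtains \<Lambda> where "exp (length \<Lambda> / 16) * card T \<le> N"
    and "\<And>n. card T / 2 \<le> norm (fsum N T n) \<Longrightarrow> n \<in> signed_span N \<Lambda>"
proof -
  let ?P = "\<lambda>\<Lambda>. dissociated N \<Lambda> \<and> (\<forall>l\<in>set \<Lambda>. card T / 2 \<le> norm (fsum N T l))"
  have T0: "real (card T) > 0"
    using T finite_subset by (fastforce simp: card_gt_0_iff)
  \<comment> \<open>The uniform length bound guarantees that a longest admissible list
    exists.\<close>
  have bound: "length \<Lambda> \<le> nat \<lceil>16 * ln (N / card T)\<rceil>" if "?P \<Lambda>" for \<Lambda>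
  proof -
    have "exp (length \<Lambda> / 16) * card T \<le> N"
      using dissociated_spectrum_length[OF N T] that by blast
    then have "exp (length \<Lambda> / 16) \<le> N / card T" using T0 by (simp add: field_simps)
    then have "length \<Lambda> / 16 \<le> ln (N / card T)"
      using N T0 by (subst ln_ge_iff) auto
    then show ?thesis by linarith
  qed
  have "?P []" by simp
  then obtain \<Lambda> where \<Lambda>: "?P \<Lambda>" "\<And>\<Lambda>'. ?P \<Lambda>' \<Longrightarrow> length \<Lambda>' \<le> length \<Lambda>"
    using ex_has_greatest_nat[of ?P "[]" length] le_imp_less_Suc[OF bound] by blast
  show thesis
  proof
    show "exp (length \<Lambda> / 16) * card T \<le> N"
      using dissociated_spectrum_length[OF N T] \<Lambda>(1) by blast
    fix n assume n: "card T / 2 \<le> norm (fsum N T n)"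
    show "n \<in> signed_span N \<Lambda>"
    proof (rule ccontr)
      assume "n \<notin> signed_span N \<Lambda>"
      then have "?P (n # \<Lambda>)" using \<Lambda>(1) n by simp
      from \<Lambda>(2)[OF this] show False by simp
    qed
  qed
qed

section \<open>Croot-Sisask sampling\<close>

text \<open>Most samples \<open>u \<in> B\<^sup>m\<close> approximate the average of \<open>f\<close> over \<open>x - B\<close> for most \<open>x\<close>. Averaging over
  \<open>v\<close> in \<open>(Z/NZ)\<^sup>m\<close> yields one \<open>v\<close> with many diagonal translates \<open>v + (t, \<dots>, t)\<close> among these samples.\<close>

lemma sampling_translates:
  fixes f :: "int \<Rightarrow> real"
  assumes N: "N > 0" and per: "\<And>x y. x mod int N = y mod int N \<Longrightarrow> f x = f y" and f: "\<And>x. 0 \<le> f x" "\<And>x. f x \<le> 1"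
    and B: "B \<subseteq> {0..<int N}" "B \<noteq> {}" and e: "0 \<le> e" "e \<le> 1" and m: "m > 0"
  obtains T v where "T \<subseteq> {0..<int N}" and "length v = m"
    and "real N * card B ^ m \<le> 2 * N ^ m * card T"
    and "\<forall>t\<in>T. card {x\<in>{0..<int N}.
        e < \<bar>(\<Sum>b\<leftarrow>v. f (x - t - b)) / m - (\<Sum>b\<in>B. f (x - b)) / card B\<bar>}
      \<le> 4 * real N * exp (- e\<^sup>2 * m / 4)"
proof -
  define Z where "Z = {0..<int N}"
  define F where "F x = (\<Sum>b\<in>B. f (x - b)) / card B" for x
  define X where "X = {u. set u \<subseteq> B \<and> length u = m}"
  define Y where "Y = {u. set u \<subseteq> Z \<and> length u = m}"
  define E where "E = exp (- e\<^sup>2 * m / 4)"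
  \<comment> \<open>A sample u is bad at x. Subtracting F x inside the sum gives terms of mean zero
    over B and modulus at most 1, as Hoeffding's inequality requires.\<close>
  define R where "R u x \<longleftrightarrow> e * m < \<bar>\<Sum>b\<leftarrow>u. f (x - b) - F x\<bar>" for u x
  \<comment> \<open>The threshold is twice the bound 2 N E for the average number of bad points of a
    sample, so by Markov's inequality at least half of all samples are good.\<close>
  define G where "G = {u\<in>X. card {x\<in>Z. R u x} \<le> 4 * N * E}"
  define shift where "shift t = map (\<lambda>b. (b + t) mod int N)" for t
  have finZ: "finite Z" and cardZ: "card Z = N" by (auto simp: Z_def)
  have finB: "finite B" using B(1) finite_subset by blast
  then have cB: "real (card B) > 0" using B(2) by (simp add: card_gt_0_iff)
  have finX: "finite X" and cardX: "card X = card B ^ m"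
    unfolding X_def using finB by (auto simp: finite_lists_length_eq card_lists_length_eq)
  have finY: "finite Y" and cardY: "card Y = N ^ m"
    unfolding Y_def using finZ cardZ by (auto simp: finite_lists_length_eq card_lists_length_eq)
  have E: "E > 0" by (simp add: E_def)
  have sumf: "(\<Sum>b\<in>B. f (x - b)) = card B * F x" for x
    using cB by (simp add: F_def)
  have F: "0 \<le> F x" "F x \<le> 1" for x
  proof -
    have "(\<Sum>b\<in>B. f (x - b)) \<le> (\<Sum>b\<in>B. 1)" by (intro sum_mono f)
    then show "F x \<le> 1" using cB by (simp add: F_def field_simps)
    show "0 \<le> F x" unfolding F_def by (intro divide_nonneg_nonneg sum_nonneg f) auto
  qed
  \<comment> \<open>Bad pairs (u, x) are counted by x instead of by u, so that Hoeffding's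
    inequality applies at each fixed x.\<close>
  have "real (\<Sum>u\<in>X. card {x\<in>Z. R u x}) = real (\<Sum>x\<in>Z. card {u\<in>X. R u x})"
    by (subst sum_multicount_gen[OF finX finZ]) auto
  also have "\<dots> \<le> (\<Sum>x\<in>Z. 2 * real (card B) ^ m * E)"
    unfolding of_nat_sum
  proof (rule sum_mono)
    fix x
    have le: "\<bar>f (x - b) - F x\<bar> \<le> 1" if "b \<in> B" for b
      using f[of "x - b"] F[of x] by linarith
    have sum0: "(\<Sum>b\<in>B. f (x - b) - F x) = 0" by (simp add: sum_subtractf sumf)
    have "real (card {u. set u \<subseteq> B \<and> length u = m \<and> e * m < \<bar>\<Sum>b\<leftarrow>u. f (x - b) - F x\<bar>})
        \<le> 2 * real (card B) ^ m * E"
      unfolding E_def by (rule Hoeffding_lists[OF finB le sum0 e])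
    then show "real (card {u\<in>X. R u x}) \<le> 2 * real (card B) ^ m * E"
      by (simp add: X_def R_def)
  qed
  also have "\<dots> = N * (2 * real (card B) ^ m * E)" by (simp add: cardZ)
  finally have total: "(\<Sum>u\<in>X. real (card {x\<in>Z. R u x})) \<le> N * (2 * real (card B) ^ m * E)" by simp
  have "real (card (X - G)) * (4 * N * E) = (\<Sum>u\<in>X - G. 4 * N * E)" by simp
  also have "\<dots> \<le> (\<Sum>u\<in>X - G. real (card {x\<in>Z. R u x}))"
    by (intro sum_mono) (auto simp: G_def)
  also have "\<dots> \<le> (\<Sum>u\<in>X. real (card {x\<in>Z. R u x}))"
    using finX by (intro sum_mono2) auto
  also have "\<dots> \<le> (real (card B) ^ m / 2) * (4 * N * E)"
    using total by (simp add: algebra_simps)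
  finally have "real (card (X - G)) * (4 * N * E) \<le> (real (card B) ^ m / 2) * (4 * N * E)" .
  then have "real (card (X - G)) \<le> real (card B) ^ m / 2"
    by (rule mult_right_le_imp_le) (use N E in simp)
  moreover have "card (X - G) + card G = card X"
    using card_Diff_subset[of G X] card_mono[of X G] finX finite_subset[of G X] by (force simp: G_def)
  then have "real (card (X - G)) + real (card G) = real (card B) ^ m"
    using cardX by (metis of_nat_add of_nat_power)
  ultimately have cardG: "real (card B) ^ m \<le> 2 * real (card G)" by linarith
  \<comment> \<open>On G, whose entries are reduced modulo N, \<open>shift (- t)\<close> supplies a
    preimage under \<open>shift t\<close>.\<close>
  have cardG_le: "card G \<le> card {v\<in>Y. shift t v \<in> G}" for t
  proof -
    have "G \<subseteq> shift t ` {v\<in>Y. shift t v \<in> G}"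
    proof
      fix u assume u: "u \<in> G"
      then have uB: "set u \<subseteq> Z" "length u = m" using B(1) by (auto simp: G_def X_def Z_def)
      have "shift t (shift (- t) u) = map (\<lambda>b. b mod int N) u"
        by (simp add: shift_def mod_simps)
      also have "\<dots> = u" using uB by (intro map_idI) (auto simp: Z_def)
      finally have eq: "shift t (shift (- t) u) = u" .
      moreover have "shift (- t) u \<in> Y" using uB N by (auto simp: Y_def shift_def Z_def)
      ultimately show "u \<in> shift t ` {v\<in>Y. shift t v \<in> G}"
        using u by (intro image_eqI[of _ _ "shift (- t) u"]) auto
    qed
    then show ?thesis using finY by (intro surj_card_le) auto
  qed
  \<comment> \<open>Pigeonhole: there are at least N |G| pairs (v, t) with \<open>shift t v\<close>
    in G, spread over N^m choices of v.\<close>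
  have "\<exists>v\<in>Y. N * card G \<le> N ^ m * card {t\<in>Z. shift t v \<in> G}"
  proof (rule ccontr)
    assume "\<not> ?thesis"
    then have less: "N ^ m * card {t\<in>Z. shift t v \<in> G} < N * card G" if "v \<in> Y" for v
      using that by force
    have "Y \<noteq> {}" using cardY N by force
    then have "(\<Sum>v\<in>Y. N ^ m * card {t\<in>Z. shift t v \<in> G}) < (\<Sum>v\<in>Y. N * card G)"
      using less by (intro sum_strict_mono finY)
    also have "\<dots> = N ^ m * (\<Sum>t\<in>Z. card G)" by (simp add: cardY cardZ)
    also have "\<dots> \<le> N ^ m * (\<Sum>t\<in>Z. card {v\<in>Y. shift t v \<in> G})"
      by (intro mult_left_mono sum_mono cardG_le) auto
    also have "\<dots> = N ^ m * (\<Sum>v\<in>Y. card {t\<in>Z. shift t v \<in> G})"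
      by (subst sum_multicount_gen[OF finY finZ]) auto
    finally show False by (simp add: sum_distrib_left)
  qed
  then obtain v where v: "v \<in> Y" "N * card G \<le> N ^ m * card {t\<in>Z. shift t v \<in> G}" by blast
  define T where "T = {t\<in>Z. shift t v \<in> G}"
  show thesis
  proof
    show "T \<subseteq> {0..<int N}" by (auto simp: T_def Z_def)
    show "length v = m" using v by (simp add: Y_def)
    have "real N * card G \<le> real N ^ m * card T"
      using v(2) unfolding T_def by (metis of_nat_le_iff of_nat_mult of_nat_power)
    moreover have "real N * card B ^ m \<le> real N * (2 * card G)"
      using cardG by (intro mult_left_mono) auto
    ultimately show "real N * card B ^ m \<le> 2 * N ^ m * card T" by simp
    show "\<forall>t\<in>T. card {x\<in>{0..<int N}.
        e < \<bar>(\<Sum>b\<leftarrow>v. f (x - t - b)) / m - (\<Sum>b\<in>B. f (x - b)) / card B\<bar>}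
      \<le> 4 * real N * exp (- e\<^sup>2 * m / 4)"
    proof
      fix t assume t: "t \<in> T"
      have "R (shift t v) x" if "e < \<bar>(\<Sum>b\<leftarrow>v. f (x - t - b)) / m - F x\<bar>" for x
      proof -
        have "f (x - (b + t) mod int N) = f (x - t - b)" for b
          by (rule per) (simp add: mod_simps algebra_simps)
        then have "(\<Sum>b\<leftarrow>shift t v. f (x - b) - F x) = (\<Sum>b\<leftarrow>v. f (x - t - b)) - m * F x"
          using \<open>length v = m\<close> by (simp add: shift_def o_def sum_list_subtractf sum_list_triv)
        also have "\<dots> = m * ((\<Sum>b\<leftarrow>v. f (x - t - b)) / m - F x)"
          using m by (simp add: right_diff_distrib)
        finally show ?thesis using that m by (simp add: R_def abs_mult)
      qed
      then have "card {x\<in>Z. e < \<bar>(\<Sum>b\<leftarrow>v. f (x - t - b)) / m - F x\<bar>} \<le> card {x\<in>Z. R (shift t v) x}"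
        using finZ by (intro card_mono) auto
      moreover have "card {x\<in>Z. R (shift t v) x} \<le> 4 * N * E"
        using t by (simp add: T_def G_def)
      ultimately show "card {x\<in>{0..<int N}.
          e < \<bar>(\<Sum>b\<leftarrow>v. f (x - t - b)) / m - (\<Sum>b\<in>B. f (x - b)) / card B\<bar>}
        \<le> 4 * real N * exp (- e\<^sup>2 * m / 4)"
        by (simp add: Z_def F_def E_def)
    qed
  qed
qed

section \<open>Almost periods\<close>

definition ind :: "nat \<Rightarrow> int set \<Rightarrow> int \<Rightarrow> real" where
  "ind N A x = of_bool (x mod int N \<in> A)"

text \<open>The triple convolution of the indicator functions, as a real-valued N-periodic function
  on the integers.\<close>

definition rep :: "nat \<Rightarrow> int set \<Rightarrow> int set \<Rightarrow> int set \<Rightarrow> int \<Rightarrow> real" where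
  "rep N A B C y = (\<Sum>b\<in>B. \<Sum>c\<in>C. ind N A (y - b - c))"

text \<open>The sampling estimate allows a few exceptional points; the sum over C smooths them out
  and gives a bound at every y. All translates by T are compared with one function K that does not
  depend on t.\<close>

lemma rep_almost_periods:
  fixes e :: real
  assumes N: "N > 0" and B: "B \<subseteq> {0..<int N}" "B \<noteq> {}" and C: "C \<subseteq> {0..<int N}"
    and e: "0 \<le> e" "e \<le> 1" and m: "m > 0"
  obtains T where "T \<subseteq> {0..<int N}" and "real N * card B ^ m \<le> 2 * N ^ m * card T"
    and "\<And>y t t'. t \<in> T \<Longrightarrow> t' \<in> T \<Longrightarrow> \<bar>rep N A B C (y + t - t') - rep N A B C y\<bar>
      \<le> 2 * (card B * (e * card C + 4 * real N * exp (- e\<^sup>2 * m / 4)))"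
proof -
  define f where "f = ind N A"
  have per: "f x = f y" if "x mod int N = y mod int N" for x y using that by (simp add: f_def ind_def)
  have f: "0 \<le> f x" "f x \<le> 1" for x by (auto simp: f_def ind_def)
  obtain T v where T: "T \<subseteq> {0..<int N}" and v: "length v = m"
    and cardT: "real N * card B ^ m \<le> 2 * N ^ m * card T"
    and bad: "\<forall>t\<in>T. card {x\<in>{0..<int N}.
        e < \<bar>(\<Sum>b\<leftarrow>v. f (x - t - b)) / m - (\<Sum>b\<in>B. f (x - b)) / card B\<bar>}
      \<le> 4 * real N * exp (- e\<^sup>2 * m / 4)"
    by (rule sampling_translates[where f = f, OF N per f B e m])
  define F where "F x = (\<Sum>b\<in>B. f (x - b)) / card B" for x
  define H where "H x = (\<Sum>b\<leftarrow>v. f (x - b)) / m" for x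
  define K where "K y = card B * (\<Sum>c\<in>C. H (y - c))" for y
  have finB: "finite B" and finC: "finite C" using B(1) C finite_subset by blast+
  then have cB: "real (card B) > 0" using B(2) by (simp add: card_gt_0_iff)
  have F: "0 \<le> F x" "F x \<le> 1" for x
  proof -
    have "(\<Sum>b\<in>B. f (x - b)) \<le> (\<Sum>b\<in>B. 1)" by (intro sum_mono f)
    then show "F x \<le> 1" using cB by (simp add: F_def field_simps)
    show "0 \<le> F x" unfolding F_def by (intro divide_nonneg_nonneg sum_nonneg f) auto
  qed
  have H: "0 \<le> H x" "H x \<le> 1" for x
  proof -
    have "(\<Sum>b\<leftarrow>v. f (x - b)) \<le> (\<Sum>b\<leftarrow>v. 1)" by (intro sum_list_mono f)
    then show "H x \<le> 1" using m v by (simp add: H_def field_simps sum_list_triv)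
    show "0 \<le> H x" unfolding H_def by (intro divide_nonneg_nonneg sum_list_nonneg) (use f in auto)
  qed
  have perF: "F (x mod int N) = F x" for x
  proof -
    have "f (x mod int N - b) = f (x - b)" for b
      by (rule per) (simp add: mod_simps)
    then show ?thesis by (simp add: F_def)
  qed
  have perH: "H x = H y" if "x mod int N = y mod int N" for x y
  proof -
    have "f (x - b) = f (y - b)" for b
      by (rule per) (metis that mod_diff_left_eq)
    then show ?thesis by (simp add: H_def)
  qed
  have rep: "rep N A B C y = card B * (\<Sum>c\<in>C. F (y - c))" for y
  proof -
    have "rep N A B C y = (\<Sum>c\<in>C. \<Sum>b\<in>B. f (y - c - b))"
      unfolding rep_def f_def by (subst sum.swap) (simp add: algebra_simps)
    then show ?thesis using cB by (simp add: F_def sum_divide_distrib[symmetric])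
  qed
  have close: "\<bar>rep N A B C (y + t) - K y\<bar> \<le> card B * (e * card C + 4 * real N * exp (- e\<^sup>2 * m / 4))"
    if t: "t \<in> T" for y t
  proof -
    define D where "D = {x\<in>{0..<int N}. e < \<bar>H (x - t) - F x\<bar>}"
    have D: "card D \<le> 4 * real N * exp (- e\<^sup>2 * m / 4)"
      using bad t by (simp add: D_def H_def F_def)
    \<comment> \<open>At exceptional residues only the trivial bound 1 is available, since both
      values lie in [0, 1].\<close>
    have pt: "\<bar>F (y + t - c) - H (y - c)\<bar> \<le> e + of_bool ((y + t - c) mod int N \<in> D)" for c
    proof -
      let ?x = "(y + t - c) mod int N"
      have Fx: "F (y + t - c) = F ?x" by (simp add: perF)
      have Hx: "H (y - c) = H (?x - t)" by (rule perH) (simp add: mod_simps)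
      have "?x \<in> {0..<int N}" using N by simp
      then show ?thesis
        using F[of ?x] H[of "?x - t"] e unfolding Fx Hx by (cases "?x \<in> D") (auto simp: D_def)
    qed
    \<comment> \<open>Injectivity lets each exceptional residue be met by at most one c, so the
      total exceptional loss is at most |D|.\<close>
    have inj: "inj_on (\<lambda>c. (y + t - c) mod int N) C"
    proof (rule inj_onI)
      fix c c' assume c: "c \<in> C" "c' \<in> C" "(y + t - c) mod int N = (y + t - c') mod int N"
      then have "(y + t - (y + t - c)) mod int N = (y + t - (y + t - c')) mod int N"
        by (metis mod_diff_right_eq)
      then have "c mod int N = c' mod int N" by simp
      then show "c = c'"
        using c(1,2) C by (metis atLeastLessThan_iff mod_pos_pos_trivial subsetD)
    qed
    have "(\<Sum>c\<in>C. \<bar>F (y + t - c) - H (y - c)\<bar>)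
        \<le> (\<Sum>c\<in>C. e + of_bool ((y + t - c) mod int N \<in> D))"
      by (intro sum_mono pt)
    also have "\<dots> = e * card C + card {c\<in>C. (y + t - c) mod int N \<in> D}"
      using finC by (simp add: sum.distrib Int_def)
    also have "card {c\<in>C. (y + t - c) mod int N \<in> D} \<le> card D"
    proof (rule card_inj_on_le)
      show "inj_on (\<lambda>c. (y + t - c) mod int N) {c\<in>C. (y + t - c) mod int N \<in> D}"
        using inj by (rule inj_on_subset) auto
      show "finite D" unfolding D_def by (rule finite_subset[of _ "{0..<int N}"]) auto
    qed auto
    finally have "(\<Sum>c\<in>C. \<bar>F (y + t - c) - H (y - c)\<bar>) \<le> e * card C + 4 * real N * exp (- e\<^sup>2 * m / 4)"
      using D by simp
    moreover have "\<bar>\<Sum>c\<in>C. F (y + t - c) - H (y - c)\<bar> \<le> (\<Sum>c\<in>C. \<bar>F (y + t - c) - H (y - c)\<bar>)"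
      by (rule sum_abs)
    ultimately have "\<bar>\<Sum>c\<in>C. F (y + t - c) - H (y - c)\<bar>
        \<le> e * card C + 4 * real N * exp (- e\<^sup>2 * m / 4)"
      by linarith
    then have "card B * \<bar>\<Sum>c\<in>C. F (y + t - c) - H (y - c)\<bar>
        \<le> card B * (e * card C + 4 * real N * exp (- e\<^sup>2 * m / 4))"
      by (rule mult_left_mono) simp
    moreover have "rep N A B C (y + t) - K y = card B * (\<Sum>c\<in>C. F (y + t - c) - H (y - c))"
      by (simp add: rep K_def sum_subtractf right_diff_distrib)
    ultimately show ?thesis by (simp add: abs_mult)
  qed
  show thesis
  proof (rule that[OF T cardT])
    fix y t t' assume "t \<in> T" "t' \<in> T"
    then show "\<bar>rep N A B C (y + t - t') - rep N A B C y\<bar>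
      \<le> 2 * (card B * (e * card C + 4 * real N * exp (- e\<^sup>2 * m / 4)))"
      \<comment> \<open>Both rep at y + t - t' and rep at y = (y - t') + t' are close to K at y -
        t'.\<close>
      using close[of t "y - t'"] close[of t' "y - t'"] by (simp add: algebra_simps)
  qed
qed

section \<open>Fourier analysis of the representation function\<close>

lemma norm_fsum_uminus: "norm (fsum N A (- n)) = norm (fsum N A n)"
proof -
  have "fsum N A (- n) = cnj (fsum N A n)" by (simp add: fsum_def ec_minus)
  then show ?thesis by simp
qed

lemma dvd_diff_residues_iff:
  assumes "a \<in> {0..<int N}" "b \<in> {0..<int N}"
  shows "int N dvd a - b \<longleftrightarrow> a = b"
  using assms by (metis atLeastLessThan_iff mod_eq_dvd_iff mod_pos_pos_trivial)

lemma fsum_Parseval: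
  assumes N: "N > 0" and A: "A \<subseteq> {0..<int N}"
  shows "(\<Sum>n\<in>{0..<int N}. (norm (fsum N A n))\<^sup>2) = N * card A"
proof -
  have finA: "finite A" using A finite_subset by blast
  have "complex_of_real (\<Sum>n\<in>{0..<int N}. (norm (fsum N A n))\<^sup>2)
      = (\<Sum>n\<in>{0..<int N}. \<Sum>a\<in>A. \<Sum>b\<in>A. ec N ((a - b) * n))"
    by (simp only: of_real_sum complex_norm_square) (simp add: fsum_def sum_product ec_diff algebra_simps)
  also have "\<dots> = (\<Sum>a\<in>A. \<Sum>b\<in>A. \<Sum>n\<in>{0..<int N}. ec N ((a - b) * n))"
    by (subst sum.swap) (intro sum.cong refl sum.swap)
  also have "\<dots> = (\<Sum>a\<in>A. \<Sum>b\<in>A. if a = b then of_nat N else 0)"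
    using A by (intro sum.cong refl) (auto simp: sum_ec[OF N] dvd_diff_residues_iff subset_iff)
  also have "\<dots> = of_real (N * card A)"
    using finA by simp
  finally show ?thesis by (simp only: of_real_eq_iff)
qed

text \<open>Fourier inversion: summing over n detects a = y - b - c modulo N. The negative arguments
  compensate the sign convention of \<open>fsum\<close>.\<close>

lemma rep_Fourier:
  assumes N: "N > 0" and A: "A \<subseteq> {0..<int N}"
  shows "complex_of_real (rep N A B C y) = (\<Sum>n\<in>{0..<int N}.
    fsum N A (- n) * fsum N B (- n) * fsum N C (- n) / N * ec N (n * y))"
proof -
  have finA: "finite A" using A finite_subset by blast
  have ind: "(\<Sum>a\<in>A. if int N dvd x - a then of_nat N else 0) = (N * ind N A x :: complex)" for x
  proof -
    have "int N dvd x - a \<longleftrightarrow> a = x mod int N" if "a \<in> A" for a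
    proof -
      have "int N dvd x - a \<longleftrightarrow> x mod int N = a mod int N" by (simp add: mod_eq_dvd_iff)
      also have "a mod int N = a" using that A by auto
      finally show ?thesis by auto
    qed
    then have "(\<Sum>a\<in>A. if int N dvd x - a then of_nat N else 0)
        = (\<Sum>a\<in>A. if a = x mod int N then complex_of_nat N else 0)"
      by (intro sum.cong refl) auto
    then show ?thesis using finA by (simp add: ind_def)
  qed
  have "N * (\<Sum>n\<in>{0..<int N}. fsum N A (- n) * fsum N B (- n) * fsum N C (- n) / N * ec N (n * y))
      = (\<Sum>n\<in>{0..<int N}. fsum N A (- n) * (fsum N B (- n) * fsum N C (- n)) * ec N (n * y))"
    using N by (simp add: sum_distrib_left mult_ac)
  also have "\<dots> = (\<Sum>n\<in>{0..<int N}. \<Sum>a\<in>A. \<Sum>b\<in>B. \<Sum>c\<in>C. ec N ((y - b - c - a) * n))"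
  proof (rule sum.cong[OF refl])
    fix n
    have "(\<Sum>a\<in>A. \<Sum>b\<in>B. \<Sum>c\<in>C. ec N ((y - b - c - a) * n))
        = (\<Sum>a\<in>A. \<Sum>b\<in>B. \<Sum>c\<in>C. ec N (- n * a) * (ec N (- n * b) * (ec N (- n * c) * ec N (n * y))))"
      by (simp add: ec_add[symmetric] algebra_simps)
    then show "fsum N A (- n) * (fsum N B (- n) * fsum N C (- n)) * ec N (n * y)
        = (\<Sum>a\<in>A. \<Sum>b\<in>B. \<Sum>c\<in>C. ec N ((y - b - c - a) * n))"
      by (simp only: sum_distrib_left[symmetric] sum_distrib_right[symmetric] fsum_def mult.assoc)
  qed
  also have "\<dots> = (\<Sum>b\<in>B. \<Sum>c\<in>C. \<Sum>a\<in>A. \<Sum>n\<in>{0..<int N}. ec N ((y - b - c - a) * n))"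
  proof -
    have "(\<Sum>n\<in>{0..<int N}. \<Sum>a\<in>A. \<Sum>b\<in>B. \<Sum>c\<in>C. ec N ((y - b - c - a) * n))
        = (\<Sum>a\<in>A. \<Sum>b\<in>B. \<Sum>c\<in>C. \<Sum>n\<in>{0..<int N}. ec N ((y - b - c - a) * n))"
      by (simp only: sum.swap[of _ _ "{0..<int N}"])
    also have "\<dots> = (\<Sum>b\<in>B. \<Sum>a\<in>A. \<Sum>c\<in>C. \<Sum>n\<in>{0..<int N}. ec N ((y - b - c - a) * n))"
      by (rule sum.swap)
    also have "\<dots> = (\<Sum>b\<in>B. \<Sum>c\<in>C. \<Sum>a\<in>A. \<Sum>n\<in>{0..<int N}. ec N ((y - b - c - a) * n))"
      by (intro sum.cong refl sum.swap)
    finally show ?thesis .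
  qed
  also have "\<dots> = (\<Sum>b\<in>B. \<Sum>c\<in>C. N * ind N A (y - b - c))"
    by (simp add: sum_ec[OF N] ind)
  also have "\<dots> = N * complex_of_real (rep N A B C y)"
    by (simp add: rep_def sum_distrib_left)
  finally show ?thesis using N by simp
qed

text \<open>The transform of C is bounded trivially by N; those of A and B are treated by the
  inequality of means and Parseval. Compared with the mean of \<open>rep\<close> this loses 1 /
  (\<alpha> \<beta> \<gamma>), which a logarithmic number of averagings recovers.\<close>

lemma sum_norm_rep_Fourier:
  assumes N: "N > 0" and A: "A \<subseteq> {0..<int N}" and B: "B \<subseteq> {0..<int N}" and C: "C \<subseteq> {0..<int N}"
  shows "(\<Sum>n\<in>{0..<int N}. norm (fsum N A (- n) * fsum N B (- n) * fsum N C (- n) / N)) \<le> (real N)\<^sup>2"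
proof -
  have card_le: "card S \<le> N" if "S \<subseteq> {0..<int N}" for S :: "int set"
    using card_mono[OF _ that] by simp
  have normC: "norm (fsum N C n) \<le> N" for n
  proof -
    have "norm (fsum N C n) \<le> (\<Sum>c\<in>C. norm (ec N (n * c)))"
      unfolding fsum_def by (rule norm_sum)
    then show ?thesis using card_le[OF C] by simp
  qed
  have "norm (fsum N A (- n) * fsum N B (- n) * fsum N C (- n) / N)
      \<le> ((norm (fsum N A n))\<^sup>2 + (norm (fsum N B n))\<^sup>2) / 2" for n
  proof -
    have "norm (fsum N A (- n) * fsum N B (- n) * fsum N C (- n) / N)
        = norm (fsum N A n) * norm (fsum N B n) * (norm (fsum N C n) / N)"
      by (simp add: norm_mult norm_divide norm_fsum_uminus)
    also have "\<dots> \<le> norm (fsum N A n) * norm (fsum N B n) * 1"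
      using normC[of n] N by (intro mult_left_mono) auto
    also have "\<dots> \<le> ((norm (fsum N A n))\<^sup>2 + (norm (fsum N B n))\<^sup>2) / 2"
      using sum_squares_bound[of "norm (fsum N A n)" "norm (fsum N B n)"] by simp
    finally show ?thesis .
  qed
  then have "(\<Sum>n\<in>{0..<int N}. norm (fsum N A (- n) * fsum N B (- n) * fsum N C (- n) / N))
      \<le> (\<Sum>n\<in>{0..<int N}. ((norm (fsum N A n))\<^sup>2 + (norm (fsum N B n))\<^sup>2) / 2)"
    by (rule sum_mono)
  also have "\<dots> = (N * card A + N * card B) / 2"
    using fsum_Parseval[OF N A] fsum_Parseval[OF N B]
    by (simp add: sum.distrib sum_divide_distrib[symmetric])
  also have "\<dots> \<le> (N * N + N * N) / 2"
    using card_le[OF A] card_le[OF B] by (intro divide_right_mono of_nat_mono add_mono mult_left_mono) auto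
  also have "\<dots> = (real N)\<^sup>2" by (simp add: power2_eq_square)
  finally show ?thesis .
qed

text \<open>Convolution k times with the distribution of t' - t for independent uniform t, t' in T.
  Using differences makes the Fourier multiplier real and nonnegative.\<close>

primrec avg_diff :: "int set \<Rightarrow> nat \<Rightarrow> (int \<Rightarrow> complex) \<Rightarrow> int \<Rightarrow> complex" where
  "avg_diff T 0 g y = g y"
| "avg_diff T (Suc k) g y = (\<Sum>t\<in>T. \<Sum>t'\<in>T. avg_diff T k g (y + t - t')) / (of_nat (card T))\<^sup>2"

text \<open>Each averaging costs at most r, by the triangle inequality under the mean.\<close>

lemma avg_diff_close:
  assumes T: "finite T" "T \<noteq> {}"
    and r: "\<And>y t t'. t \<in> T \<Longrightarrow> t' \<in> T \<Longrightarrow> norm (g (y + t - t') - g y) \<le> r"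
  shows "norm (avg_diff T k g y - g y) \<le> k * r"
proof (induction k arbitrary: y)
  case (Suc k)
  define M where "M = (of_nat (card T) :: complex)\<^sup>2"
  have M: "M \<noteq> 0" and normM: "norm M = real (card T) * card T"
    using T by (simp_all add: M_def power2_eq_square norm_mult)
  have "(\<Sum>t\<in>T. \<Sum>t'\<in>T. g y) = M * g y"
    by (simp add: M_def power2_eq_square)
  then have "avg_diff T (Suc k) g y - g y
      = (\<Sum>t\<in>T. \<Sum>t'\<in>T. avg_diff T k g (y + t - t') - g y) / M"
    using M by (simp add: M_def[symmetric] sum_subtractf field_simps)
  also have "norm \<dots> \<le> (\<Sum>t\<in>T. \<Sum>t'\<in>T. Suc k * r) / norm M"
    unfolding norm_divide
  proof (intro divide_right_mono order_trans[OF norm_sum] sum_mono norm_ge_zero)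
    fix t t' assume t: "t \<in> T" "t' \<in> T"
    have "norm (avg_diff T k g (y + t - t') - g y)
        \<le> norm (avg_diff T k g (y + t - t') - g (y + t - t')) + norm (g (y + t - t') - g y)"
      by (rule norm_triangle_ineq[THEN order_trans[rotated], of _ _ _]) simp
    also have "\<dots> \<le> k * r + r" by (intro add_mono Suc.IH r t)
    finally show "norm (avg_diff T k g (y + t - t') - g y) \<le> Suc k * r"
      by (simp add: ring_distribs)
  qed
  also have "\<dots> = Suc k * r"
    using T unfolding normM by simp
  finally show ?case .
qed simp

text \<open>Characters are eigenfunctions of one averaging, with eigenvalue (|fsum| /
  |T|)^2.\<close>

lemma avg_diff_Fourier:
  assumes g: "\<And>y. g y = (\<Sum>n\<in>S. w n * ec N (n * y))"
  shows "avg_diff T k g y = (\<Sum>n\<in>S. w n * of_real ((norm (fsum N T n) / card T) ^ (2 * k)) * ec N (n * y))"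
proof (induction k arbitrary: y)
  case 0
  then show ?case by (simp add: g)
next
  case (Suc k)
  define q where "q n = complex_of_real ((norm (fsum N T n) / card T) ^ (2 * k))" for n
  have sum_ec: "(\<Sum>t\<in>T. \<Sum>t'\<in>T. ec N (n * (y + t - t'))) = of_real ((norm (fsum N T n))\<^sup>2) * ec N (n * y)" for n
  proof -
    have "(\<Sum>t\<in>T. \<Sum>t'\<in>T. ec N (n * (y + t - t')))
        = (\<Sum>t\<in>T. \<Sum>t'\<in>T. (ec N (n * t) * cnj (ec N (n * t'))) * ec N (n * y))"
      by (simp only: right_diff_distrib distrib_left ec_diff ec_add) (simp add: mult_ac)
    also have "\<dots> = (fsum N T n * cnj (fsum N T n)) * ec N (n * y)"
      by (simp only: fsum_def cnj_sum sum_product) (simp only: sum_distrib_right)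
    finally show ?thesis by (simp only: complex_norm_square)
  qed
  have "(\<Sum>t\<in>T. \<Sum>t'\<in>T. avg_diff T k g (y + t - t'))
      = (\<Sum>n\<in>S. \<Sum>t\<in>T. \<Sum>t'\<in>T. w n * q n * ec N (n * (y + t - t')))"
    unfolding Suc.IH q_def[symmetric] by (simp only: sum.swap[of _ T S])
  also have "\<dots> = (\<Sum>n\<in>S. w n * q n * (of_real ((norm (fsum N T n))\<^sup>2) * ec N (n * y)))"
    by (simp only: sum_distrib_left[symmetric] sum_ec)
  finally show ?case
    by (simp add: sum_divide_distrib q_def power_add power2_eq_square field_simps)
qed

text \<open>Iterated averaging over \<open>T - T\<close> changes the representation function by little and damps its
  Fourier coefficients outside the large spectrum of \<open>T\<close> by \<open>4 ^ (- k)\<close>.\<close>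

lemma rep_Bohr:
  fixes h r :: real
  assumes N: "N > 0" and A: "A \<subseteq> {0..<int N}" and B: "B \<subseteq> {0..<int N}" and C: "C \<subseteq> {0..<int N}"
    and T: "T \<subseteq> {0..<int N}" "T \<noteq> {}"
    and r: "\<And>y t t'. t \<in> T \<Longrightarrow> t' \<in> T \<Longrightarrow> \<bar>rep N A B C (y + t - t') - rep N A B C y\<bar> \<le> r"
    and \<Lambda>: "\<And>n. card T / 2 \<le> norm (fsum N T n) \<Longrightarrow> n \<in> signed_span N \<Lambda>"
    and s: "\<And>l. l \<in> set \<Lambda> \<Longrightarrow> norm (ec N (l * s) - 1) \<le> h" and h: "0 \<le> h"
  shows "\<bar>rep N A B C (y + s) - rep N A B C y\<bar> \<le> 2 * real k * r + (length \<Lambda> * h + 2 / 4 ^ k) * (real N)\<^sup>2"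
proof -
  define g where "g y = complex_of_real (rep N A B C y)" for y
  define w where "w n = fsum N A (- n) * fsum N B (- n) * fsum N C (- n) / N" for n
  define q where "q n = (norm (fsum N T n) / card T) ^ (2 * k)" for n
  define G where "G = avg_diff T k g"
  have finT: "finite T" using T(1) finite_subset by blast
  then have cT: "real (card T) > 0" using T(2) by (simp add: card_gt_0_iff)
  have g: "g y = (\<Sum>n\<in>{0..<int N}. w n * ec N (n * y))" for y
    unfolding g_def w_def by (rule rep_Fourier[OF N A])
  have G: "G y = (\<Sum>n\<in>{0..<int N}. w n * of_real (q n) * ec N (n * y))" for y
    unfolding G_def q_def by (rule avg_diff_Fourier[OF g])
  have close: "norm (G y - g y) \<le> k * r" for y
    unfolding G_def
  proof (rule avg_diff_close[OF finT T(2)])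
    fix y t t' assume "t \<in> T" "t' \<in> T"
    then show "norm (g (y + t - t') - g y) \<le> r"
      using r by (simp only: g_def of_real_diff[symmetric] norm_of_real)
  qed
  have q_nonneg: "0 \<le> q n" for n by (simp add: q_def)
  \<comment> \<open>Large spectrum: q is at most 1 and the span bounds the character difference.
    Elsewhere: the ratio is below 1/2, so q is at most 4^(-k) and the difference is at most
    2.\<close>
  have term_le: "q n * norm (ec N (n * s) - 1) \<le> length \<Lambda> * h + 2 / 4 ^ k" for n
  proof (cases "card T / 2 \<le> norm (fsum N T n)")
    case True
    have "norm (fsum N T n) \<le> (\<Sum>t\<in>T. norm (ec N (n * t)))"
      unfolding fsum_def by (rule norm_sum)
    then have "norm (fsum N T n) / card T \<le> 1" using cT by simp
    then have "q n \<le> 1" unfolding q_def by (intro power_le_one) auto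
    then have "q n * norm (ec N (n * s) - 1) \<le> 1 * (length \<Lambda> * h)"
      by (intro mult_mono norm_ec_signed_span[OF N \<Lambda>[OF True] s]) auto
    then show ?thesis by (simp add: add_increasing2)
  next
    case False
    then have "norm (fsum N T n) / card T \<le> 1 / 2" using cT by (simp add: field_simps)
    then have "q n \<le> (1 / 2) ^ (2 * k)" unfolding q_def by (intro power_mono) auto
    also have "\<dots> = 1 / 4 ^ k" by (simp add: power_mult power_one_over power2_eq_square)
    finally have "q n \<le> 1 / 4 ^ k" .
    moreover have "norm (ec N (n * s) - 1) \<le> 2"
      using norm_triangle_ineq4[of "ec N (n * s)" 1] by simp
    ultimately have "q n * norm (ec N (n * s) - 1) \<le> 1 / 4 ^ k * 2"
      by (intro mult_mono) auto
    then show ?thesis using h by (simp add: add_increasing)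
  qed
  have "G (y + s) - G y = (\<Sum>n\<in>{0..<int N}. w n * (of_real (q n) * (ec N (n * s) - 1)) * ec N (n * y))"
    unfolding G sum_subtractf[symmetric] by (intro sum.cong refl) (simp only: distrib_left ec_add, simp add: algebra_simps)
  also have "norm \<dots> \<le> (\<Sum>n\<in>{0..<int N}. norm (w n) * (length \<Lambda> * h + 2 / 4 ^ k))"
  proof (intro order_trans[OF norm_sum] sum_mono)
    fix n
    have "norm (of_real (q n) * (ec N (n * s) - 1)) = q n * norm (ec N (n * s) - 1)"
      using q_nonneg by (simp add: norm_mult)
    then have "norm (of_real (q n) * (ec N (n * s) - 1)) \<le> length \<Lambda> * h + 2 / 4 ^ k"
      using term_le by simp
    then show "norm (w n * (of_real (q n) * (ec N (n * s) - 1)) * ec N (n * y))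
        \<le> norm (w n) * (length \<Lambda> * h + 2 / 4 ^ k)"
      unfolding norm_mult[of "w n * _"] norm_mult[of "w n"] norm_ec mult_1_right
      by (intro mult_left_mono) auto
  qed
  also have "\<dots> = (\<Sum>n\<in>{0..<int N}. norm (w n)) * (length \<Lambda> * h + 2 / 4 ^ k)"
    by (simp add: sum_distrib_right)
  also have "\<dots> \<le> (real N)\<^sup>2 * (length \<Lambda> * h + 2 / 4 ^ k)"
    unfolding w_def by (intro mult_right_mono sum_norm_rep_Fourier N A B C) (use h in auto)
  finally have "norm (G (y + s) - G y) \<le> (length \<Lambda> * h + 2 / 4 ^ k) * (real N)\<^sup>2"
    by (simp add: mult.commute)
  moreover have "norm (g (y + s) - g y) \<le> norm (G (y + s) - G y) + norm (G (y + s) - g (y + s)) + norm (G y - g y)"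
  proof -
    have eq: "g (y + s) - g y = (G (y + s) - G y) - (G (y + s) - g (y + s)) + (G y - g y)" by simp
    show ?thesis
      by (subst eq) (rule order_trans[OF norm_triangle_ineq add_right_mono[OF norm_triangle_ineq4]])
  qed
  moreover have "norm (g (y + s) - g y) = \<bar>rep N A B C (y + s) - rep N A B C y\<bar>"
    by (simp only: g_def of_real_diff[symmetric] norm_of_real)
  ultimately show ?thesis using close[of y] close[of "y + s"] by linarith
qed

section \<open>Progressions of popular sums\<close>

text \<open>Simultaneous approximation of all l / N with one denominator s; multiplying the
  approximation by j multiplies the error by j.\<close>

lemma Dirichlet_Bohr:
  assumes N: "N > 0" and Q: "Q > 0"
  obtains s :: nat where "0 < s" "s \<le> Q ^ length \<Lambda>"
    and "\<And>l j. l \<in> set \<Lambda> \<Longrightarrow> norm (ec N (l * int (j * s)) - 1) \<le> 2 * pi * j / Q"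
proof -
  obtain q p where q: "0 < q" "q \<le> int (Q ^ length \<Lambda>)"
    and p: "\<And>i. i < length \<Lambda> \<Longrightarrow> \<bar>of_int q * (of_int (\<Lambda> ! i) / real N) - of_int (p i)\<bar> < 1 / Q"
    using Dirichlet_approx_simult[OF Q, where \<theta> = "\<lambda>i. of_int (\<Lambda> ! i) / real N" and n = "length \<Lambda>"]
    by metis
  show thesis
  proof
    show "0 < nat q" "nat q \<le> Q ^ length \<Lambda>" using q by (simp_all add: nat_le_iff)
    fix l j assume "l \<in> set \<Lambda>"
    then obtain i where i: "i < length \<Lambda>" "\<Lambda> ! i = l" by (auto simp: in_set_conv_nth)
    have l: "l * int (j * nat q) = l * (int j * q)" using q by simp
    have eq: "of_int (l * (int j * q)) / real N - of_int (int j * p i)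
        = j * (of_int q * (of_int l / real N) - of_int (p i))"
      by (simp add: algebra_simps)
    have "norm (ec N (l * int (j * nat q)) - 1)
        \<le> 2 * pi * \<bar>of_int (l * (int j * q)) / real N - of_int (int j * p i)\<bar>"
      unfolding l by (rule norm_ec_near[OF N])
    also have "\<dots> = 2 * pi * (j * \<bar>of_int q * (of_int l / real N) - of_int (p i)\<bar>)"
      by (simp only: eq abs_mult abs_of_nat)
    also have "\<dots> \<le> 2 * pi * (j * (1 / Q))"
      using p[OF i(1)] i(2) by (intro mult_left_mono) auto
    finally show "norm (ec N (l * int (j * nat q)) - 1) \<le> 2 * pi * j / Q" by simp
  qed
qed

text \<open>For fixed b and c, every element of A is hit as y runs through the residues, so the sum
  of \<open>rep\<close> over y is at least |A| |B| |C|.\<close>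

lemma exists_rep_ge_average:
  assumes N: "N > 0" and A: "A \<subseteq> {0..<int N}"
  shows "\<exists>y\<in>{0..<int N}. card A * card B * card C \<le> N * rep N A B C y"
proof (rule ccontr)
  assume "\<not> ?thesis"
  then have less: "N * rep N A B C y < card A * card B * card C" if "y \<in> {0..<int N}" for y
    using that by force
  have ge: "card A \<le> (\<Sum>y\<in>{0..<int N}. ind N A (y - u))" for u
  proof -
    have "card A \<le> card {y\<in>{0..<int N}. (y - u) mod int N \<in> A}"
    proof (rule card_inj_on_le)
      show "inj_on (\<lambda>a. (a + u) mod int N) A"
      proof (rule inj_onI)
        fix a a' assume a: "a \<in> A" "a' \<in> A" "(a + u) mod int N = (a' + u) mod int N"
        then have "a mod int N = a' mod int N" by (metis add_diff_cancel_right' mod_diff_left_eq)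
        then show "a = a'" using a(1,2) A by (metis atLeastLessThan_iff mod_pos_pos_trivial subsetD)
      qed
      show "(\<lambda>a. (a + u) mod int N) ` A \<subseteq> {y\<in>{0..<int N}. (y - u) mod int N \<in> A}"
        using A N by (auto simp: mod_simps subset_iff)
      show "finite {y\<in>{0..<int N}. (y - u) mod int N \<in> A}"
        by (rule finite_subset[of _ "{0..<int N}"]) auto
    qed
    also have "{y\<in>{0..<int N}. (y - u) mod int N \<in> A} = {0..<int N} \<inter> {y. (y - u) mod int N \<in> A}"
      by auto
    finally show ?thesis by (simp add: ind_def)
  qed
  have "N * (card A * card B * card C) = N * (\<Sum>b\<in>B. \<Sum>c\<in>C. real (card A))" by simp
  also have "\<dots> \<le> N * (\<Sum>b\<in>B. \<Sum>c\<in>C. \<Sum>y\<in>{0..<int N}. ind N A (y - (b + c)))"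
    by (intro mult_left_mono sum_mono ge) auto
  also have "(\<Sum>b\<in>B. \<Sum>c\<in>C. \<Sum>y\<in>{0..<int N}. ind N A (y - (b + c))) = (\<Sum>y\<in>{0..<int N}. rep N A B C y)"
    by (simp only: sum.swap[of _ _ "{0..<int N}"] rep_def diff_diff_add)
  also have "N * \<dots> = (\<Sum>y\<in>{0..<int N}. N * rep N A B C y)" by (simp add: sum_distrib_left)
  also have "\<dots> < (\<Sum>y\<in>{0..<int N}. real (card A * card B * card C))"
    using N by (intro sum_strict_mono less) auto
  finally show False by simp
qed

text \<open>Passage from natural residues to the integer model: b, c and the target determine a
  modulo N.\<close>

lemma reps3_eq_rep:
  assumes N: "N > 0" and A: "A \<subseteq> {..<N}" and B: "B \<subseteq> {..<N}" and C: "C \<subseteq> {..<N}"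
  shows "real (reps3 N A B C (nat (y mod int N))) = rep N (int ` A) (int ` B) (int ` C) y"
proof -
  define t where "t = nat (y mod int N)"
  have fin: "finite A" "finite B" "finite C" using A B C finite_subset by blast+
  have iff: "(a + b + c) mod N = t \<longleftrightarrow> int a = (y - int b - int c) mod int N" if "a \<in> A" for a b c
  proof -
    have "(a + b + c) mod N = t \<longleftrightarrow> (int a + int b + int c) mod int N = y mod int N"
    proof -
      have "(a + b + c) mod N = t \<longleftrightarrow> int ((a + b + c) mod N) = int t" by simp
      also have "int t = y mod int N" using N by (simp add: t_def)
      finally show ?thesis by (simp add: zmod_int)
    qed
    also have "\<dots> \<longleftrightarrow> int a mod int N = (y - int b - int c) mod int N"
      by (simp add: mod_eq_dvd_iff algebra_simps)
    also have "int a mod int N = int a" using that A by auto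
    finally show ?thesis .
  qed
  have "{(a, b, c). a \<in> A \<and> b \<in> B \<and> c \<in> C \<and> (a + b + c) mod N = t}
      = (A \<times> B \<times> C) \<inter> {p. (fst p + fst (snd p) + snd (snd p)) mod N = t}"
    by auto
  then have "real (reps3 N A B C t)
      = (\<Sum>p\<in>A \<times> B \<times> C. of_bool ((fst p + fst (snd p) + snd (snd p)) mod N = t))"
    using fin by (simp add: reps3_def)
  also have "\<dots> = (\<Sum>a\<in>A. \<Sum>b\<in>B. \<Sum>c\<in>C. of_bool ((a + b + c) mod N = t))"
    by (simp add: sum.cartesian_product case_prod_unfold)
  also have "\<dots> = (\<Sum>b\<in>B. \<Sum>c\<in>C. \<Sum>a\<in>A. of_bool ((a + b + c) mod N = t))"
    by (simp only: sum.swap[of _ _ A])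
  also have "\<dots> = (\<Sum>b\<in>B. \<Sum>c\<in>C. ind N (int ` A) (y - int b - int c))"
  proof (intro sum.cong refl)
    fix b c
    have "(\<Sum>a\<in>A. of_bool ((a + b + c) mod N = t))
        = (\<Sum>a\<in>int ` A. if a = (y - int b - int c) mod int N then 1 else (0::real))"
      by (subst sum.reindex) (auto simp: iff of_bool_def intro!: sum.cong)
    then show "(\<Sum>a\<in>A. of_bool ((a + b + c) mod N = t)) = ind N (int ` A) (y - int b - int c)"
      using fin by (simp add: ind_def)
  qed
  also have "\<dots> = rep N (int ` A) (int ` B) (int ` C) y"
    by (simp add: rep_def sum.reindex)
  finally show ?thesis by (simp add: t_def)
qed

text \<open>Here d is the size of the spanning list of the large spectrum of T. The start y carries
  at least the mean, and the subtracted error collects the averaging loss and the Fourier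
  loss.\<close>

lemma rep_progression:
  fixes e :: real and k L :: nat
  assumes N: "N > 0" and A: "A \<subseteq> {0..<int N}" and B: "B \<subseteq> {0..<int N}" "B \<noteq> {}"
    and C: "C \<subseteq> {0..<int N}" and e: "0 \<le> e" "e \<le> 1" and m: "m > 0" and Q: "Q > 0"
  obtains y :: int and s d :: nat where "0 < s" "s \<le> Q ^ d" "exp (d / 16) \<le> 2 / (card B / N) ^ m"
    and "\<And>j. j < L \<Longrightarrow> card A * card B * card C / N
      - (4 * real k * card B * (e * card C + 4 * real N * exp (- e\<^sup>2 * m / 4))
         + (d * (2 * pi * L / Q) + 2 / 4 ^ k) * (real N)\<^sup>2) \<le> rep N A B C (y + int (j * s))"
proof -
  define r where "r = 2 * (card B * (e * card C + 4 * real N * exp (- e\<^sup>2 * m / 4)))"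
  obtain T where T: "T \<subseteq> {0..<int N}" and cardT: "real N * card B ^ m \<le> 2 * N ^ m * card T"
    and r: "\<And>y t t'. t \<in> T \<Longrightarrow> t' \<in> T \<Longrightarrow> \<bar>rep N A B C (y + t - t') - rep N A B C y\<bar> \<le> r"
    using rep_almost_periods[OF N B C e m] unfolding r_def by metis
  have cB: "real (card B) > 0" using B finite_subset by (fastforce simp: card_gt_0_iff)
  then have "0 < real N * card B ^ m" using N by simp
  with cardT have cT: "real (card T) > 0" by (cases "card T = 0") auto
  then have T0: "T \<noteq> {}" by auto
  obtain \<Lambda> where len: "exp (length \<Lambda> / 16) * card T \<le> N"
    and \<Lambda>: "\<And>n. card T / 2 \<le> norm (fsum N T n) \<Longrightarrow> n \<in> signed_span N \<Lambda>"
    using Chang[OF N T T0] by metis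
  obtain s where s: "0 < s" "s \<le> Q ^ length \<Lambda>"
    and s_\<Lambda>: "\<And>l j. l \<in> set \<Lambda> \<Longrightarrow> norm (ec N (l * int (j * s)) - 1) \<le> 2 * pi * j / Q"
    using Dirichlet_Bohr[OF N Q] by metis
  obtain y where y: "card A * card B * card C \<le> N * rep N A B C y"
    using exists_rep_ge_average[OF N A] by blast
  show thesis
  proof (rule that[OF s])
    \<comment> \<open>Chang's bound is combined with the lower bound for |T|, which has density at
      least half the m-th power of that of B.\<close>
    have "exp (length \<Lambda> / 16) * (real N * card B ^ m) \<le> exp (length \<Lambda> / 16) * (2 * N ^ m * card T)"
      using cardT by (intro mult_left_mono) auto
    also have "\<dots> = 2 * N ^ m * (exp (length \<Lambda> / 16) * card T)" by simp
    also have "\<dots> \<le> 2 * N ^ m * N" 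
      using mult_left_mono[OF len, of "2 * real N ^ m"] by simp
    finally have "exp (length \<Lambda> / 16) * card B ^ m \<le> 2 * N ^ m" using N by simp
    then show "exp (length \<Lambda> / 16) \<le> 2 / (card B / N) ^ m"
      using cB N by (simp add: power_divide field_simps)
    fix j assume j: "j < L"
    \<comment> \<open>One bound, with L in place of j, serves all terms of the progression.\<close>
    have s': "norm (ec N (l * int (j * s)) - 1) \<le> 2 * pi * L / Q" if "l \<in> set \<Lambda>" for l
    proof (rule order_trans[OF s_\<Lambda>[OF that]])
      show "2 * pi * j / Q \<le> 2 * pi * L / Q" using j by (intro divide_right_mono mult_left_mono) auto
    qed
    have "\<bar>rep N A B C (y + int (j * s)) - rep N A B C y\<bar>
        \<le> 2 * real k * r + (length \<Lambda> * (2 * pi * L / Q) + 2 / 4 ^ k) * (real N)\<^sup>2"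
      by (rule rep_Bohr[OF N A B(1) C T T0 r \<Lambda> s']) auto
    moreover have "card A * card B * card C / N \<le> rep N A B C y"
      using y N by (simp add: field_simps)
    ultimately show "card A * card B * card C / N
      - (4 * real k * card B * (e * card C + 4 * real N * exp (- e\<^sup>2 * m / 4))
         + (length \<Lambda> * (2 * pi * L / Q) + 2 / 4 ^ k) * (real N)\<^sup>2) \<le> rep N A B C (y + int (j * s))"
      by (simp add: r_def)
  qed
qed

section \<open>Choice of parameters\<close>

text \<open>The parameters are fixed in the order k, e, m: k for the Fourier damping, e so that k
  averagings are affordable, m so that the exceptional points cost no more than e \<gamma>.\<close>

lemma sampling_parameters:
  fixes \<alpha> \<beta> \<gamma> :: real
  assumes a: "0 < \<alpha>" "\<alpha> \<le> 1" and b: "0 < \<beta>" "\<beta> \<le> 1" and c: "0 < \<gamma>" "\<gamma> \<le> 1"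
  defines "L \<equiv> ln (2 / (\<alpha> * \<beta> * \<gamma>))"
  obtains k m :: nat and e :: real where "0 \<le> e" "e \<le> 1" "m > 0"
    and "4 * real k * \<beta> * (e * \<gamma> + 4 * exp (- e\<^sup>2 * m / 4)) \<le> \<alpha> * \<beta> * \<gamma> / 4"
    and "2 / 4 ^ k \<le> \<alpha> * \<beta> * \<gamma> / 8"
    and "\<And>d. exp (d / 16) \<le> 2 / \<beta> ^ m \<Longrightarrow> d \<le> 10 ^ 8 * L ^ 4 / \<alpha>\<^sup>2"
proof -
  have abc: "0 < \<alpha> * \<beta> * \<gamma>" using a b c by simp
  have abc1: "\<alpha> * \<beta> * \<gamma> \<le> \<alpha> * \<gamma>" "\<alpha> * \<beta> * \<gamma> \<le> \<beta>" "\<alpha> * \<gamma> \<le> 1"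
    using a b c mult_left_le[of \<beta> "\<alpha> * \<gamma>"] mult_left_le[of "\<alpha> * \<gamma>" \<beta>]
    by (simp_all add: mult_ac mult_le_one)
  have expL: "exp L = 2 / (\<alpha> * \<beta> * \<gamma>)" unfolding L_def using abc by simp
  have L: "ln 2 \<le> L"
    unfolding L_def using abc abc1 b by (subst ln_le_cancel_iff) (auto simp: field_simps)
  then have L23: "2 / 3 \<le> L" using ln2_ge_two_thirds by linarith
  have exp2: "2 \<le> exp L" using L by (metis exp_le_cancel_iff exp_ln zero_less_numeral)
  \<comment> \<open>The extra 3 gives 4^k \<ge> exp k \<ge> 8 exp L, where exp L = 2 / (\<alpha>
    \<beta> \<gamma>).\<close>
  define k where "k = nat \<lceil>L + 3\<rceil>"
  \<comment> \<open>Chosen so that 4 k \<beta> (2 e \<gamma>) is exactly \<alpha> \<beta> \<gamma> /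
    4.\<close>
  define e where "e = \<alpha> / (32 * k)"
  \<comment> \<open>The factor 56 = 4 * 14 makes the Hoeffding exponent at least 14 L; the 14 splits
    below as 6 + 7 + 1, for the constant 64, for k and for exp L.\<close>
  define M where "M = 56 * L / e\<^sup>2"
  define m where "m = nat \<lceil>M\<rceil>"
  have k: "L + 3 \<le> k" "k \<le> 7 * L" using L23 unfolding k_def by linarith+
  have k0: "real k \<ge> 1" using k L23 by linarith
  have e: "0 < e" "e \<le> 1" using a k0 by (auto simp: e_def field_simps)
  have "1 \<le> 56 * L" using L23 by linarith
  also have "\<dots> \<le> M" unfolding M_def using e L23 by (simp add: le_divide_eq mult_left_le power_le_one)
  finally have M: "1 \<le> M" .
  then have m: "M \<le> m" "m \<le> 2 * M" unfolding m_def by linarith+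
  then have m0: "m > 0" using M by linarith
  show thesis
  proof
    show "0 \<le> e" "e \<le> 1" using e by auto
    show "m > 0" by (rule m0)
    have "64 * real k * exp L \<le> exp (14 * L)"
    proof -
      have "(2::real) ^ 6 \<le> exp L ^ 6" using exp2 by (intro power_mono) auto
      then have "64 \<le> exp (6 * L)" by (simp add: exp_of_nat_mult[symmetric])
      moreover have "real k \<le> exp (7 * L)" using k exp_ge_add_one_self[of "7 * L"] by linarith
      ultimately have "64 * real k * exp L \<le> exp (6 * L) * exp (7 * L) * exp L"
        by (intro mult_right_mono mult_mono) auto
      then show ?thesis by (simp add: exp_add[symmetric])
    qed
    moreover have "128 * real k / (\<alpha> * \<gamma>) \<le> 64 * real k * exp L"
    proof -
      have "1 / (\<alpha> * \<gamma>) \<le> 1 / (\<alpha> * \<beta> * \<gamma>)"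
        using abc1(1) abc a c by (intro divide_left_mono) auto
      then have "128 * real k * (1 / (\<alpha> * \<gamma>)) \<le> 128 * real k * (1 / (\<alpha> * \<beta> * \<gamma>))"
        by (rule mult_left_mono) simp
      then show ?thesis by (simp add: expL)
    qed
    ultimately have "128 * real k / (\<alpha> * \<gamma>) \<le> exp (14 * L)" by linarith
    then have "4 * exp (- 14 * L) \<le> e * \<gamma>"
      using a c k0 by (simp add: e_def exp_minus field_simps)
    moreover have "14 * L \<le> e\<^sup>2 * m / 4"
    proof -
      have "e\<^sup>2 * M \<le> e\<^sup>2 * m" using m by (intro mult_left_mono) auto
      then show ?thesis using e by (simp add: M_def)
    qed
    then have "exp (- e\<^sup>2 * m / 4) \<le> exp (- 14 * L)" by simp
    ultimately have "e * \<gamma> + 4 * exp (- e\<^sup>2 * m / 4) \<le> 2 * (e * \<gamma>)" by linarith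
    then have "4 * real k * \<beta> * (e * \<gamma> + 4 * exp (- e\<^sup>2 * m / 4)) \<le> 4 * real k * \<beta> * (2 * (e * \<gamma>))"
      using b by (intro mult_left_mono) auto
    also have "\<dots> = \<alpha> * \<beta> * \<gamma> / 4" using k0 by (simp add: e_def)
    finally show "4 * real k * \<beta> * (e * \<gamma> + 4 * exp (- e\<^sup>2 * m / 4)) \<le> \<alpha> * \<beta> * \<gamma> / 4" .
    have "8 * exp L \<le> exp 3 * exp L"
    proof -
      have "(2::real) ^ 3 \<le> exp 1 ^ 3" by (intro power_mono exp_ge_add_one_self[of 1, simplified]) auto
      then show ?thesis by (simp add: exp_of_nat_mult[symmetric])
    qed
    also have "\<dots> \<le> exp k" using k by (simp add: exp_add[symmetric])
    also have "\<dots> = exp 1 ^ k" by (simp add: exp_of_nat_mult[symmetric])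
    also have "\<dots> \<le> 4 ^ k" using exp_le by (intro power_mono) auto
    finally show "2 / 4 ^ k \<le> \<alpha> * \<beta> * \<gamma> / 8"
      using a b c by (simp add: expL field_simps)
    fix d :: real assume d: "exp (d / 16) \<le> 2 / \<beta> ^ m"
    have "d / 16 \<le> ln (2 / \<beta> ^ m)" using d b by (subst ln_ge_iff) auto
    also have "\<dots> = ln 2 - m * ln \<beta>" using b by (simp add: ln_div ln_realpow)
    also have "- ln \<beta> \<le> L - ln 2"
    proof -
      have "L = ln 2 - ln (\<alpha> * \<beta> * \<gamma>)" unfolding L_def using a b c by (simp add: ln_div)
      moreover have "ln (\<alpha> * \<beta> * \<gamma>) \<le> ln \<beta>" using abc abc1 b by (subst ln_le_cancel_iff) auto
      ultimately show ?thesis by linarith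
    qed
    then have "ln 2 - m * ln \<beta> \<le> ln 2 + m * (L - ln 2)"
      using mult_left_mono[of "- ln \<beta>" "L - ln 2" "real m"] by simp
    \<comment> \<open>The saving m ln 2 pays for the ln 2 coming from the factor 2, because m is
      positive.\<close>
    also have "\<dots> \<le> m * L"
    proof -
      have "1 * ln 2 \<le> real m * ln 2" using m0 by (intro mult_right_mono) auto
      then show ?thesis by (simp add: right_diff_distrib)
    qed
    also have "\<dots> \<le> 2 * M * L" using m L23 by (intro mult_right_mono) auto
    finally have "d \<le> 32 * (M * L)" by simp
    also have "\<dots> = 32 * 56 * 1024 * (L\<^sup>2 * real k ^ 2) / \<alpha>\<^sup>2"
      using a k0 by (simp add: M_def e_def power2_eq_square field_simps)
    also have "\<dots> \<le> 32 * 56 * 1024 * (L\<^sup>2 * (7 * L) ^ 2) / \<alpha>\<^sup>2"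
      using k by (intro divide_right_mono mult_left_mono power_mono) auto
    \<comment> \<open>The constant is 32 * 56 * 1024 * 49 = 89915392.\<close>
    also have "\<dots> \<le> 10 ^ 8 * L ^ 4 / \<alpha>\<^sup>2"
      using L23 by (intro divide_right_mono) (auto simp: power2_eq_square power4_eq_xxxx)
    finally show "d \<le> 10 ^ 8 * L ^ 4 / \<alpha>\<^sup>2" .
  qed
qed

text \<open>With l about exp Y, Q is the least integer making the Dirichlet error small for all d up
  to D. As L \<le> Y, every polynomial factor is absorbed into a power of exp Y: l into the 2nd and
  Q into the 42nd, whence the constant 44.\<close>

lemma progression_parameters:
  fixes \<alpha> \<delta> L Y :: real
  assumes a: "0 < \<delta>" "\<delta> \<le> \<alpha>" "\<alpha> \<le> 1" and L: "L = ln (2 / \<delta>)" and Y: "L \<le> Y"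
    and N: "44 * 10 ^ 8 * L ^ 4 / \<alpha>\<^sup>2 * Y \<le> ln N" and N0: "N > 0"
  obtains l Q :: nat where "exp Y \<le> l" "Q > 0"
    and "\<And>d. d \<le> 10 ^ 8 * L ^ 4 / \<alpha>\<^sup>2 \<Longrightarrow> d * (2 * pi * l / Q) \<le> \<delta> / 8"
    and "\<And>d::nat. d \<le> 10 ^ 8 * L ^ 4 / \<alpha>\<^sup>2 \<Longrightarrow> real l * real Q ^ d \<le> N"
proof -
  have expL: "exp L = 2 / \<delta>" unfolding L using a by simp
  have L2: "ln 2 \<le> L" unfolding L using a by (subst ln_le_cancel_iff) (auto simp: field_simps)
  then have L23: "2 / 3 \<le> L" using ln2_ge_two_thirds by linarith
  have exp2: "2 \<le> exp L" using L2 by (metis exp_le_cancel_iff exp_ln zero_less_numeral)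
  have pow2: "2 ^ n \<le> exp (n * L)" for n
    using power_mono[OF exp2, of n] by (simp add: exp_of_nat_mult)
  define D where "D = 10 ^ 8 * L ^ 4 / \<alpha>\<^sup>2"
  define l where "l = nat \<lceil>exp Y\<rceil>"
  define X where "X = D * (2 * pi * l) * (8 / \<delta>)"
  define Q where "Q = nat \<lceil>X\<rceil>"
  have Y1: "1 \<le> exp Y" using L23 Y by simp
  then have l: "exp Y \<le> l" "l \<le> 2 * exp Y" unfolding l_def by linarith+
  have l1: "1 \<le> real l" using l(1) Y1 by linarith
  have a2: "0 < \<alpha>\<^sup>2" "\<alpha>\<^sup>2 \<le> 1" using a by (auto simp: power_le_one)
  have "(1::real) \<le> 10 ^ 8 * (2 / 3) ^ 4" by (simp add: power4_eq_xxxx)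
  also have "\<dots> \<le> 10 ^ 8 * L ^ 4" using L23 by (intro mult_left_mono power_mono) auto
  also have "\<dots> \<le> D" unfolding D_def using a2 by (simp add: le_divide_eq mult_left_le)
  finally have D: "1 \<le> D" .
  have "1 * (2 * 3 * 1) * (8 / 1) \<le> X"
    unfolding X_def using D l1 pi_gt3 a
    by (intro mult_mono) (auto simp: field_simps)
  then have X: "1 \<le> X" by simp
  then have Q: "X \<le> Q" "Q \<le> 2 * X" unfolding Q_def by linarith+
  \<comment> \<open>The exponent is 27 + 4 + 2: 10^8 \<le> 2^27, then the fourth power of L, then
    the inverse square of \<alpha>.\<close>
  have D_le: "D \<le> exp (33 * Y)"
  proof -
    have "1 / \<alpha> \<le> exp L" unfolding expL using a by (intro frac_le) auto
    then have "(1 / \<alpha>)\<^sup>2 \<le> exp L ^ 2" using a by (intro power_mono) auto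
    moreover have "L ^ 4 \<le> exp L ^ 4"
      using exp_ge_add_one_self[of L] L23 by (intro power_mono) linarith+
    moreover have "10 ^ 8 \<le> exp (27 * L)" using pow2[of 27] by simp
    ultimately have "10 ^ 8 * L ^ 4 * (1 / \<alpha>)\<^sup>2 \<le> exp (27 * L) * exp L ^ 4 * exp L ^ 2"
      using L23 by (intro mult_mono) auto
    also have "\<dots> = exp (33 * L)" by (simp add: exp_of_nat_mult[symmetric] exp_add[symmetric])
    also have "\<dots> \<le> exp (33 * Y)" using Y by simp
    finally show ?thesis by (simp add: D_def power_divide)
  qed
  have "X \<le> exp (33 * Y) * (2 * 4 * (2 * exp Y)) * (4 * exp L)"
    unfolding X_def expL using D_le l pi_less_4 D a by (intro mult_mono) auto
  also have "\<dots> = 2 ^ 6 * exp (34 * Y) * exp L"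
    by (simp add: exp_add[symmetric])
  finally have "Q \<le> 2 ^ 7 * exp (34 * Y) * exp L" using Q by simp
  also have "\<dots> \<le> exp (7 * L) * exp (34 * Y) * exp L"
    using pow2[of 7] by (intro mult_right_mono) auto
  also have "\<dots> \<le> exp (42 * Y)" using Y by (simp add: exp_add[symmetric])
  finally have Q_le: "Q \<le> exp (42 * Y)" .
  have "l \<le> exp L * exp Y" by (rule order_trans[OF l(2)]) (simp add: exp2)
  also have "\<dots> \<le> exp (2 * Y)" using Y by (simp add: exp_add[symmetric])
  finally have l_le: "l \<le> exp (2 * Y)" .
  show thesis
  proof
    show "exp Y \<le> l" by (rule l)
    show Q0: "Q > 0" using X Q by linarith
    fix d :: real assume "d \<le> 10 ^ 8 * L ^ 4 / \<alpha>\<^sup>2"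
    then have "d \<le> D" by (simp add: D_def)
    then have "d * (2 * pi * l) * (8 / \<delta>) \<le> X" 
      unfolding X_def using a by (intro mult_right_mono) auto
    also note Q(1)
    finally show "d * (2 * pi * l / Q) \<le> \<delta> / 8"
      using a Q0 by (simp add: field_simps)
  next
    fix d :: nat assume "d \<le> 10 ^ 8 * L ^ 4 / \<alpha>\<^sup>2"
    then have d: "d \<le> D" by (simp add: D_def)
    have Y0: "0 \<le> Y" using L23 Y by linarith
    have "real l * real Q ^ d \<le> exp (2 * Y) * exp (42 * Y) ^ d"
      using l_le Q_le by (intro mult_mono power_mono) auto
    also have "\<dots> = exp (2 * Y + d * (42 * Y))" by (simp add: exp_add exp_of_nat_mult)
    \<comment> \<open>The bound D \<ge> 1 pays for the factor l, also when d = 0.\<close>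
    also have "\<dots> \<le> exp (D * (2 * Y) + D * (42 * Y))"
      using d D Y0 mult_right_mono[OF D, of "2 * Y"] mult_right_mono[OF d, of "42 * Y"] by simp
    also have "\<dots> = exp (44 * 10 ^ 8 * L ^ 4 / \<alpha>\<^sup>2 * Y)" by (simp add: D_def)
    also have "\<dots> \<le> exp (ln N)" using N by simp
    finally show "real l * real Q ^ d \<le> N" using N0 by simp
  qed
qed

section \<open>Assembly of the progression\<close>

theorem theorem1p4:
  shows "\<exists>c::real. c > 0 \<and>
    (\<forall>(N::nat) A B C.
      real N \<ge> 1 + exp (exp (exp 1)) \<longrightarrow>
      A \<subseteq> {..<N} \<longrightarrow> B \<subseteq> {..<N} \<longrightarrow> C \<subseteq> {..<N} \<longrightarrow>
      A \<noteq> {} \<longrightarrow> B \<noteq> {} \<longrightarrow> C \<noteq> {} \<longrightarrow>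
      (let \<alpha> = real (card A) / real N; \<beta> = real (card B) / real N;
           \<gamma> = real (card C) / real N in
        \<alpha> * (ln (2 / (\<alpha> * \<beta> * \<gamma>))) powr (-5/2) \<ge> (c * ln (real N)) powr (-1/2) \<longrightarrow>
        (\<exists>a d L. real L \<ge> real N powr (c * \<alpha>^2 / (ln (2 / (\<alpha> * \<beta> * \<gamma>)))^4) \<and>
           inj_on (\<lambda>i. (a + i * d) mod N) {..<L} \<and>
           ap_mod N a d L \<subseteq> sumset3 N A B C \<and>
           (\<forall>t \<in> ap_mod N a d L. real (reps3 N A B C t) \<ge> 1/2 * \<alpha> * \<beta> * \<gamma> * (real N)^2))))"
proof (intro exI[of _ "1 / 10 ^ 10"] conjI allI impI)
  show "0 < (1 / 10 ^ 10 :: real)" by simp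
  fix N :: nat and A B C :: "nat set"
  assume N_ge: "real N \<ge> 1 + exp (exp (exp 1))"
    and sub: "A \<subseteq> {..<N}" "B \<subseteq> {..<N}" "C \<subseteq> {..<N}" and ne: "A \<noteq> {}" "B \<noteq> {}" "C \<noteq> {}"
  \<comment> \<open>Small enough that 44 * 10^8 * c is below 1, as the room for l Q^d inside N
    demands.\<close>
  define c :: real where "c = 1 / 10 ^ 10"
  define \<alpha> \<beta> \<gamma> where "\<alpha> = real (card A) / real N" and "\<beta> = real (card B) / real N"
    and "\<gamma> = real (card C) / real N"
  define L where "L = ln (2 / (\<alpha> * \<beta> * \<gamma>))"
  have N1: "real N > 1" using N_ge by (smt (verit) exp_gt_zero)
  then have N: "N > 0" and lnN: "ln N > 0" by simp_all
  have dens: "0 < card S / N" "card S / N \<le> 1" if "S \<subseteq> {..<N}" "S \<noteq> {}" for S :: "nat set"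
    using that N card_mono[of "{..<N}" S] finite_subset[of S "{..<N}"] by (auto simp: card_gt_0_iff)
  have pos: "0 < \<alpha>" "\<alpha> \<le> 1" "0 < \<beta>" "\<beta> \<le> 1" "0 < \<gamma>" "\<gamma> \<le> 1"
    using dens sub ne by (simp_all add: \<alpha>_def \<beta>_def \<gamma>_def)
  define \<delta> where "\<delta> = \<alpha> * \<beta> * \<gamma>"
  have \<delta>: "0 < \<delta>" "\<delta> \<le> \<alpha>"
    using pos mult_left_le[of "\<beta> * \<gamma>" \<alpha>] by (auto simp: \<delta>_def mult.assoc mult_le_one)
  have L_\<delta>: "L = ln (2 / \<delta>)" by (simp add: L_def \<delta>_def)
  have L0: "0 < L" unfolding L_\<delta> using \<delta> pos by (intro ln_gt_zero) (simp add: field_simps)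
  have "\<exists>a d l. real l \<ge> real N powr (c * \<alpha>\<^sup>2 / L ^ 4) \<and> inj_on (\<lambda>i. (a + i * d) mod N) {..<l} \<and>
      ap_mod N a d l \<subseteq> sumset3 N A B C \<and>
      (\<forall>t\<in>ap_mod N a d l. real (reps3 N A B C t) \<ge> 1 / 2 * \<alpha> * \<beta> * \<gamma> * (real N)\<^sup>2)"
    if hyp: "\<alpha> * L powr (-5/2) \<ge> (c * ln N) powr (-1/2)"
  proof -
    define x where "x = c * ln N"
    have x: "0 < x" using lnN by (simp add: x_def c_def)
    \<comment> \<open>Squaring the density hypothesis gives L^5 \<le> c \<alpha>^2 ln N, which is
      exactly L \<le> Y.\<close>
    have "(x powr (-1/2))\<^sup>2 \<le> (\<alpha> * L powr (-5/2))\<^sup>2"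
      using hyp by (intro power_mono) (auto simp: x_def)
    also have "(x powr (-1/2))\<^sup>2 = 1 / x"
      using x by (simp add: powr_power powr_minus_divide power_divide)
    also have "(\<alpha> * L powr (-5/2))\<^sup>2 = \<alpha>\<^sup>2 / L ^ 5"
      using L0 by (simp add: power_mult_distrib powr_power powr_minus_divide power_divide)
    finally have L5: "L ^ 5 \<le> x * \<alpha>\<^sup>2" using x L0 by (simp add: field_simps)
    \<comment> \<open>Thus exp Y is the required length of the progression.\<close>
    define Y where "Y = c * \<alpha>\<^sup>2 / L ^ 4 * ln N"
    have "L ^ 4 * L = L ^ 5" by (simp add: eval_nat_numeral)
    also note L5
    also have "x * \<alpha>\<^sup>2 = L ^ 4 * Y" using L0 by (simp add: x_def Y_def)
    finally have "L ^ 4 * L \<le> L ^ 4 * Y" .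
    then have LY: "L \<le> Y" using L0 by simp
    have "44 * 10 ^ 8 * L ^ 4 / \<alpha>\<^sup>2 * Y = 44 / 100 * ln N"
      using L0 pos by (simp add: Y_def c_def)
    also have "\<dots> \<le> ln N" using lnN by simp
    finally have Y_small: "44 * 10 ^ 8 * L ^ 4 / \<alpha>\<^sup>2 * Y \<le> ln N" .
    obtain k m e where e: "0 \<le> e" "e \<le> 1" and m: "m > 0"
      and err1: "4 * real k * \<beta> * (e * \<gamma> + 4 * exp (- e\<^sup>2 * m / 4)) \<le> \<delta> / 4"
      and err2: "2 / 4 ^ k \<le> \<delta> / 8"
      and dim: "\<And>d. exp (d / 16) \<le> 2 / \<beta> ^ m \<Longrightarrow> d \<le> 10 ^ 8 * L ^ 4 / \<alpha>\<^sup>2"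
      using sampling_parameters[OF pos] unfolding L_def \<delta>_def by metis
    obtain l Q where l: "exp Y \<le> l" and Q: "Q > 0"
      and err3: "\<And>d. d \<le> 10 ^ 8 * L ^ 4 / \<alpha>\<^sup>2 \<Longrightarrow> d * (2 * pi * l / Q) \<le> \<delta> / 8"
      and room: "\<And>d::nat. d \<le> 10 ^ 8 * L ^ 4 / \<alpha>\<^sup>2 \<Longrightarrow> real l * real Q ^ d \<le> N"
      using progression_parameters[OF \<delta> pos(2) L_\<delta> LY Y_small] N by (metis of_nat_0_less_iff)
    define A' B' C' where "A' = int ` A" and "B' = int ` B" and "C' = int ` C"
    have sub': "A' \<subseteq> {0..<int N}" "B' \<subseteq> {0..<int N}" "C' \<subseteq> {0..<int N}" "B' \<noteq> {}"
      using sub ne by (auto simp: A'_def B'_def C'_def)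
    have card': "card A' = card A" "card B' = card B" "card C' = card C"
      by (simp_all add: A'_def B'_def C'_def card_image)
    obtain y :: int and s d :: nat where s: "0 < s" "s \<le> Q ^ d"
      and d: "exp (d / 16) \<le> 2 / (card B' / N) ^ m"
      and ge: "\<And>j. j < l \<Longrightarrow> card A' * card B' * card C' / N
      - (4 * real k * card B' * (e * card C' + 4 * real N * exp (- e\<^sup>2 * m / 4))
         + (d * (2 * pi * l / Q) + 2 / 4 ^ k) * (real N)\<^sup>2) \<le> rep N A' B' C' (y + int (j * s))"
      using rep_progression[OF N sub'(1,2,4,3) e m Q] by metis
    have dD: "d \<le> 10 ^ 8 * L ^ 4 / \<alpha>\<^sup>2" using dim d by (simp add: card' \<beta>_def)
    \<comment> \<open>The losses \<delta>/4, \<delta>/8 and \<delta>/8 leave half of the mean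
      \<delta> N^2.\<close>
    have many: "\<delta> / 2 * (real N)\<^sup>2 \<le> rep N A' B' C' (y + int (j * s))" if "j < l" for j
    proof -
      have "card A' * card B' * card C' / N = \<delta> * (real N)\<^sup>2"
        using N by (simp add: card' \<delta>_def \<alpha>_def \<beta>_def \<gamma>_def power2_eq_square)
      moreover have "4 * real k * card B' * (e * card C' + 4 * real N * exp (- e\<^sup>2 * m / 4))
          = 4 * real k * \<beta> * (e * \<gamma> + 4 * exp (- e\<^sup>2 * m / 4)) * (real N)\<^sup>2"
        using N by (simp add: card' \<beta>_def \<gamma>_def power2_eq_square field_simps)
      moreover have "4 * real k * \<beta> * (e * \<gamma> + 4 * exp (- e\<^sup>2 * m / 4)) * (real N)\<^sup>2 \<le> \<delta> / 4 * (real N)\<^sup>2"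
        using err1 by (rule mult_right_mono) simp
      moreover have "(d * (2 * pi * l / Q) + 2 / 4 ^ k) * (real N)\<^sup>2 \<le> (\<delta> / 8 + \<delta> / 8) * (real N)\<^sup>2"
        by (intro mult_right_mono add_mono err3 err2 dD) simp
      ultimately have "\<delta> * (real N)\<^sup>2 - (\<delta> / 4 * (real N)\<^sup>2 + (\<delta> / 8 + \<delta> / 8) * (real N)\<^sup>2)
          \<le> rep N A' B' C' (y + int (j * s))"
        using ge[OF that] by linarith
      then show ?thesis by (simp add: algebra_simps)
    qed
    define a where "a = nat (y mod int N)"
    have int_a: "int a = y mod int N" using N by (simp add: a_def)
    have reps: "\<delta> / 2 * (real N)\<^sup>2 \<le> reps3 N A B C ((a + j * s) mod N)" if "j < l" for j
    proof -
      have "int ((a + j * s) mod N) = (y + int (j * s)) mod int N"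
        by (simp add: zmod_int int_a mod_simps)
      then have "(a + j * s) mod N = nat ((y + int (j * s)) mod int N)" by simp
      then show ?thesis
        using many[OF that] reps3_eq_rep[OF N sub, of "y + int (j * s)"]
        by (simp add: A'_def B'_def C'_def)
    qed
    \<comment> \<open>All offsets from the start lie below N, so distinct offsets stay distinct
      modulo N whether or not s is coprime to N.\<close>
    have small: "j * s < N" if "j < l" for j
    proof -
      have "j * s < l * s" using that s by simp
      also have "\<dots> \<le> l * Q ^ d" using s by simp
      also have "\<dots> \<le> N"
      proof -
        have "real (l * Q ^ d) \<le> real N" using room[OF dD] by simp
        then show ?thesis by (simp only: of_nat_le_iff)
      qed
      finally show ?thesis .
    qed
    have "inj_on (\<lambda>i. (a + i * s) mod N) {..<l}"
    proof (rule inj_onI)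
      fix i j assume ij: "i \<in> {..<l}" "j \<in> {..<l}" "(a + i * s) mod N = (a + j * s) mod N"
      then have "(int a + int (i * s)) mod int N = (int a + int (j * s)) mod int N"
        by (metis of_nat_add zmod_int)
      then have "int (i * s) mod int N = int (j * s) mod int N"
        by (simp add: mod_eq_dvd_iff)
      then have "(i * s) mod N = (j * s) mod N"
        unfolding zmod_int[symmetric] by (simp only: of_nat_eq_iff)
      then have "i * s = j * s" using small ij by simp
      then show "i = j" using s by simp
    qed
    moreover have "real N powr (c * \<alpha>\<^sup>2 / L ^ 4) \<le> l"
      using l N by (simp add: powr_def Y_def)
    moreover have "t \<in> sumset3 N A B C \<and> 1 / 2 * \<alpha> * \<beta> * \<gamma> * (real N)\<^sup>2 \<le> reps3 N A B C t"
      if t: "t \<in> ap_mod N a s l" for t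
    proof -
      have ge: "\<delta> / 2 * (real N)\<^sup>2 \<le> reps3 N A B C t" using t reps by (auto simp: ap_mod_def)
      moreover have "0 < \<delta> / 2 * (real N)\<^sup>2" using \<delta> N by simp
      ultimately have "0 < reps3 N A B C t" by linarith
      then have "{(x, y, z). x \<in> A \<and> y \<in> B \<and> z \<in> C \<and> (x + y + z) mod N = t} \<noteq> {}"
        unfolding reps3_def by (metis card.empty less_irrefl)
      then have "t \<in> sumset3 N A B C" by (auto simp: sumset3_def)
      with ge show ?thesis by (simp add: \<delta>_def)
    qed
    ultimately show ?thesis by blast
  qed
  then show "let \<alpha> = real (card A) / real N; \<beta> = real (card B) / real N;
           \<gamma> = real (card C) / real N in
        \<alpha> * (ln (2 / (\<alpha> * \<beta> * \<gamma>))) powr (-5/2) \<ge> (1 / 10 ^ 10 * ln (real N)) powr (-1/2) \<longrightarrow>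
        (\<exists>a d L. real L \<ge> real N powr (1 / 10 ^ 10 * \<alpha>^2 / (ln (2 / (\<alpha> * \<beta> * \<gamma>)))^4) \<and>
           inj_on (\<lambda>i. (a + i * d) mod N) {..<L} \<and>
           ap_mod N a d L \<subseteq> sumset3 N A B C \<and>
           (\<forall>t \<in> ap_mod N a d L. real (reps3 N A B C t) \<ge> 1/2 * \<alpha> * \<beta> * \<gamma> * (real N)^2))"
    unfolding Let_def \<alpha>_def[symmetric] \<beta>_def[symmetric] \<gamma>_def[symmetric] L_def[symmetric] c_def[symmetric]
    by blast
qed

end
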